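(* Let $\mathbb K\in\{\mathbb R,\mathbb C\}$, let $N\in\mathbb N$, let $V\subset \ell_1^N$ be a duplication-stable subspace of dimension $n\geqslant 2$, and let $\mathscr V\subset L_1[0,1]\subset M[0,1]$ be its piecewise-constant copy. (i) \[\lambda(\mathscr V,L_1[0,1])=\lambda(\mathscr V,M[0,1])=\lambda(V,\ell_1^N).\] (ii) $\mathscr V$ admits a unique minimal projection from $L_1[0,1]$ onto $\mathscr V$. (iii) There is no weak$^*$-continuous minimal projection from $M[0,1]$ onto $\mathscr V$.
   Context: All spaces are over $\mathbb K\in\{\mathbb R,\mathbb C\}$. For a closed subspace $E$ of a Banach space $F$, the projection constant is $\lambda(E,F)=\inf\{\|P\| : P\colon F\to E \text{ bounded linear},\ P|_E=\mathrm{Id}_E\}$; a minimal projection from $F$ onto $E$ is a bounded linear projection $P\colon F\to E$ (that is, $P|_E=\mathrm{Id}_E$) with $\|P\|=\lambda(E,F)$. $M[0,1]=C[0,1]^*$ is the space of regular $\mathbb K$-valued Borel measures on $[0,1]$ with the total variation norm; $L_1[0,1]$ (Lebesgue measure) is identified isometrically with the subspace of absolutely continuous measures. Weak$^*$ continuity on $M[0,1]$ refers to $\sigma(M[0,1],C[0,1])$. Piecewise-constant copy: for $N\in\mathbb N$ let $I_j=[\frac{j-1}{N},\frac jN)$ for $1\leqslant j\leqslant N-1$ and $I_N=[\frac{N-1}N,1]$, and let $\nu_j=N\chi_{I_j}\in L_1[0,1]$. Let $J_N\colon \ell_1^N\to L_1[0,1]$ be the linear isometric embedding with $J_N(e_j)=\nu_j$,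 where $(e_j)$ is the standard basis of $\ell_1^N$. For a subspace $V\subset\ell_1^N$, its piecewise-constant copy is $\mathscr V:=J_N(V)\subset L_1[0,1]\subset M[0,1]$. Duplication-stability: for $m\in\mathbb N$ let $D_m\colon\ell_1^N\to\ell_1^{Nm}$ be \[ D_m(x_1,\dots,x_N)=\Bigl(\underbrace{\tfrac{x_1}{m},\dots,\tfrac{x_1}{m}}_{m},\dots,\underbrace{\tfrac{x_N}{m},\dots,\tfrac{x_N}{m}}_{m}\Bigr). \] A subspace $V\subset\ell_1^N$ is duplication-stable if, for every $m\in\mathbb N$ (with $m\geqslant1$), $\lambda(D_m(V),\ell_1^{Nm})=\lambda(V,\ell_1^N)$ and there is exactly one minimal projection from $\ell_1^{Nm}$ onto $D_m(V)$. *)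

theory Defs
  imports "HOL-Analysis.Analysis" "HOL-Library.Function_Algebras"
begin

section \<open>The scalar field\<close>

text \<open>
  A finite-dimensional real normed field whose norm is multiplicative is isometrically isomorphic
  to the reals or to the complex numbers (Frobenius), so this class is the assumption
  that the scalar field is one of these two.
\<close>

class scalar_field = real_normed_field + euclidean_space

instance real :: scalar_field ..
instance complex :: scalar_field ..


section \<open>Normed spaces, projections and projection constants\<close>

text \<open>
  A normed space over the scalars is given by a carrier inside an abelian group, a
  scalar multiplication and a norm; the last two only matter on the carrier.
\<close>

record ('k, 'a) nspace =
  pts :: "'a set"
  smult :: "'k \<Rightarrow> 'a \<Rightarrow> 'a"
  nrm :: "'a \<Rightarrow> real"

definition linear_on_space :: "('k, 'a::ab_group_add) nspace \<Rightarrow> ('a \<Rightarrow> 'a) \<Rightarrow> bool" where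
  "linear_on_space F P \<longleftrightarrow>
     (\<forall>x\<in>pts F. \<forall>y\<in>pts F. P (x + y) = P x + P y) \<and>
     (\<forall>c. \<forall>x\<in>pts F. P (smult F c x) = smult F c (P x))"

definition bounded_on_space :: "('k, 'a) nspace \<Rightarrow> ('a \<Rightarrow> 'a) \<Rightarrow> bool" where
  "bounded_on_space F P \<longleftrightarrow> (\<exists>C. \<forall>x\<in>pts F. nrm F (P x) \<le> C * nrm F x)"

definition op_norm :: "('k, 'a) nspace \<Rightarrow> ('a \<Rightarrow> 'a) \<Rightarrow> real" where
  "op_norm F P = (SUP x\<in>{x \<in> pts F. nrm F x \<le> 1}. nrm F (P x))"

text \<open>
  Projections are taken in the extensional function space, so that equality of two
  projections means equality on the carrier.
\<close>

definition bounded_projection ::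
    "('k, 'a::ab_group_add) nspace \<Rightarrow> 'a set \<Rightarrow> ('a \<Rightarrow> 'a) \<Rightarrow> bool" where
  "bounded_projection F E P \<longleftrightarrow>
     P \<in> pts F \<rightarrow>\<^sub>E E \<and> linear_on_space F P \<and> bounded_on_space F P \<and> (\<forall>x\<in>E. P x = x)"

text \<open>The infimum is taken in the extended reals: it is infinite if there is no bounded projection.\<close>

definition proj_const :: "('k, 'a::ab_group_add) nspace \<Rightarrow> 'a set \<Rightarrow> ereal" where
  "proj_const F E = (INF P\<in>{P. bounded_projection F E P}. ereal (op_norm F P))"

definition minimal_projection ::
    "('k, 'a::ab_group_add) nspace \<Rightarrow> 'a set \<Rightarrow> ('a \<Rightarrow> 'a) \<Rightarrow> bool" where
  "minimal_projection F E P \<longleftrightarrow>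
     bounded_projection F E P \<and> ereal (op_norm F P) = proj_const F E"


section \<open>The spaces of summable vectors and duplication-stability\<close>

definition pw_scale :: "'k::times \<Rightarrow> ('i \<Rightarrow> 'k) \<Rightarrow> 'i \<Rightarrow> 'k" where
  "pw_scale c x = (\<lambda>i. c * x i)"

interpretation pw: vector_space "pw_scale :: 'k::field \<Rightarrow> ('i \<Rightarrow> 'k) \<Rightarrow> 'i \<Rightarrow> 'k"
  by unfold_locales (auto simp: pw_scale_def fun_eq_iff algebra_simps)

text \<open>Vectors with coordinates indexed by \<open>0, \<dots>, N - 1\<close>.\<close>

definition ell1 :: "nat \<Rightarrow> ('k::scalar_field, nat \<Rightarrow> 'k) nspace" where
  "ell1 N = \<lparr>pts = {x. \<forall>i\<ge>N. x i = 0}, smult = pw_scale, nrm = (\<lambda>x. \<Sum>i<N. norm (x i))\<rparr>"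

definition duplicate :: "nat \<Rightarrow> (nat \<Rightarrow> 'k::scalar_field) \<Rightarrow> nat \<Rightarrow> 'k" where
  "duplicate m x = (\<lambda>i. x (i div m) / of_nat m)"

definition duplication_stable :: "nat \<Rightarrow> (nat \<Rightarrow> 'k::scalar_field) set \<Rightarrow> bool" where
  "duplication_stable N V \<longleftrightarrow>
     pw.subspace V \<and> V \<subseteq> pts (ell1 N) \<and>
     (\<forall>m\<ge>1. proj_const (ell1 (N * m)) (duplicate m ` V) = proj_const (ell1 N) V \<and>
            (\<exists>!P. minimal_projection (ell1 (N * m)) (duplicate m ` V) P))"


section \<open>The Lebesgue space on the unit interval\<close>

quotient_type (overloaded) 'k L1 = "real \<Rightarrow> 'k::scalar_field" / partial:
  "\<lambda>f g. integrable (lebesgue_on {0..1}) f \<and> integrable (lebesgue_on {0..1}) g \<and>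
         (AE x in lebesgue_on {0..1}. f x = g x)"
proof (rule part_equivpI)
  show "\<exists>f::real \<Rightarrow> 'k. integrable (lebesgue_on {0..1}) f \<and> integrable (lebesgue_on {0..1}) f \<and>
          (AE x in lebesgue_on {0..1}. f x = f x)"
    by (rule exI[of _ "\<lambda>_. 0"]) simp
  let ?R = "\<lambda>f g :: real \<Rightarrow> 'k. integrable (lebesgue_on {0..1}) f \<and>
    integrable (lebesgue_on {0..1}) g \<and> (AE x in lebesgue_on {0..1}. f x = g x)"
  show "symp ?R"
    by (rule sympI) (simp only: eq_commute conj_ac)
  show "transp ?R"
  proof (rule transpI)
    fix f g h assume fg: "?R f g" and gh: "?R g h"
    have "AE x in lebesgue_on {0..1}. f x = h x"
      using conjunct2[OF conjunct2[OF fg]] conjunct2[OF conjunct2[OF gh]]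
      by eventually_elim (rule trans)
    with fg gh show "?R f h"
      by (iprover dest: conjunct1 conjunct2)
  qed
qed

instantiation L1 :: (scalar_field) ab_group_add
begin

lift_definition zero_L1 :: "'a L1" is "\<lambda>_. 0"
  by simp

lift_definition plus_L1 :: "'a L1 \<Rightarrow> 'a L1 \<Rightarrow> 'a L1" is "\<lambda>f g x. f x + g x"
proof (elim conjE, intro conjI)
  fix f f' g g' :: "real \<Rightarrow> 'a"
  assume "AE x in lebesgue_on {0..1}. f x = f' x" "AE x in lebesgue_on {0..1}. g x = g' x"
  then show "AE x in lebesgue_on {0..1}. f x + g x = f' x + g' x"
    by eventually_elim (rule arg_cong2)
qed (erule (1) Bochner_Integration.integrable_add)+

lift_definition uminus_L1 :: "'a L1 \<Rightarrow> 'a L1" is "\<lambda>f x. - f x"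
proof (elim conjE, intro conjI)
  fix f g :: "real \<Rightarrow> 'a"
  assume "AE x in lebesgue_on {0..1}. f x = g x"
  then show "AE x in lebesgue_on {0..1}. - f x = - g x"
    by eventually_elim (rule arg_cong)
qed (erule Bochner_Integration.integrable_minus)+

lift_definition minus_L1 :: "'a L1 \<Rightarrow> 'a L1 \<Rightarrow> 'a L1" is "\<lambda>f g x. f x - g x"
proof (elim conjE, intro conjI)
  fix f f' g g' :: "real \<Rightarrow> 'a"
  assume "AE x in lebesgue_on {0..1}. f x = f' x" "AE x in lebesgue_on {0..1}. g x = g' x"
  then show "AE x in lebesgue_on {0..1}. f x - g x = f' x - g' x"
    by eventually_elim (rule arg_cong2)
qed (erule (1) Bochner_Integration.integrable_diff)+

instance
  by standard (transfer; simp add: algebra_simps)+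

end

lift_definition L1_scale :: "'k::scalar_field \<Rightarrow> 'k L1 \<Rightarrow> 'k L1" is "\<lambda>c f x. c * f x"
proof (elim conjE, intro conjI)
  fix c :: 'k and f g :: "real \<Rightarrow> 'k"
  assume "AE x in lebesgue_on {0..1}. f x = g x"
  then show "AE x in lebesgue_on {0..1}. c * f x = c * g x"
    by eventually_elim (rule arg_cong)
qed (rule integrable_mult_right; assumption)+

lift_definition L1_norm :: "'k::scalar_field L1 \<Rightarrow> real"
  is "\<lambda>f. \<integral>x. norm (f x) \<partial>lebesgue_on {0..1}"
proof (elim conjE, rule integral_cong_AE)
  fix f g :: "real \<Rightarrow> 'k"
  assume "AE x in lebesgue_on {0..1}. f x = g x"
  then show "AE x in lebesgue_on {0..1}. norm (f x) = norm (g x)"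
    by eventually_elim (rule arg_cong)
qed (rule borel_measurable_integrable, erule integrable_norm)+

definition L1_space :: "('k::scalar_field, 'k L1) nspace" where
  "L1_space = \<lparr>pts = UNIV, smult = L1_scale, nrm = L1_norm\<rparr>"

text \<open>The cells are indexed by \<open>0, \<dots>, N - 1\<close>, like the coordinates above.\<close>

definition cell :: "nat \<Rightarrow> nat \<Rightarrow> real set" where
  "cell N j = (if Suc j = N then {real j / real N..1}
               else {real j / real N..<real (Suc j) / real N})"

lift_definition cell_density :: "nat \<Rightarrow> nat \<Rightarrow> 'k::scalar_field L1"
  is "\<lambda>N j x. of_nat N * indicator (cell N j) x"
proof -
  fix N j :: nat
  have "cell N j \<in> sets lebesgue"
    by (simp add: cell_def)
  then have "(\<lambda>x. of_nat N * indicator (cell N j) x :: 'k) \<in> borel_measurable (lebesgue_on {0..1})"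
    by (intro measurable_restrict_space1 borel_measurable_times borel_measurable_const
        borel_measurable_indicator)
  moreover have "finite_measure (lebesgue_on {0..1::real})"
    by (rule finite_measure_lebesgue_on) simp
  moreover have "AE x in lebesgue_on {0..1}. norm (of_nat N * indicator (cell N j) x :: 'k) \<le> real N"
    by (rule AE_I2) (simp add: norm_mult indicator_def)
  ultimately have "integrable (lebesgue_on {0..1}) (\<lambda>x. of_nat N * indicator (cell N j) x :: 'k)"
    by (intro finite_measure.integrable_const_bound)
  then show "integrable (lebesgue_on {0..1}) (\<lambda>x. of_nat N * indicator (cell N j) x :: 'k) \<and>
      integrable (lebesgue_on {0..1}) (\<lambda>x. of_nat N * indicator (cell N j) x :: 'k) \<and>
      (AE x in lebesgue_on {0..1}.
        of_nat N * indicator (cell N j) x = (of_nat N * indicator (cell N j) x :: 'k))"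
    by (intro conjI AE_I2 refl)
qed

definition J :: "nat \<Rightarrow> (nat \<Rightarrow> 'k::scalar_field) \<Rightarrow> 'k L1" where
  "J N x = (\<Sum>j<N. L1_scale (x j) (cell_density N j))"


section \<open>Regular Borel measures on the unit interval\<close>

text \<open>
  A scalar-valued measure is a set function on the Borel subsets of the unit interval; it is
  extended by zero to all other sets, so that equality of functions is equality of measures.
\<close>

abbreviation unit_borel :: "real measure" where
  "unit_borel \<equiv> restrict_space borel {0..1}"

definition countably_additive_measure :: "(real set \<Rightarrow> 'k::scalar_field) \<Rightarrow> bool" where
  "countably_additive_measure \<mu> \<longleftrightarrow>
     (\<forall>A::nat \<Rightarrow> real set. range A \<subseteq> sets unit_borel \<and> disjoint_family A \<longrightarrow>
        (\<lambda>i. \<mu> (A i)) sums \<mu> (\<Union>i. A i))"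

definition regular_measure :: "(real set \<Rightarrow> 'k::scalar_field) \<Rightarrow> bool" where
  "regular_measure \<mu> \<longleftrightarrow>
     (\<forall>A\<in>sets unit_borel. \<forall>e>0. \<exists>F G. closed F \<and> open G \<and> F \<subseteq> A \<and> A \<subseteq> G \<and>
        (\<forall>B\<in>sets unit_borel. B \<subseteq> G - F \<longrightarrow> norm (\<mu> B) < e))"

definition variation_sums :: "(real set \<Rightarrow> 'k::scalar_field) \<Rightarrow> real set" where
  "variation_sums \<mu> =
     {\<Sum>B\<in>\<P>. norm (\<mu> B) |\<P>. finite \<P> \<and> disjoint \<P> \<and> \<P> \<subseteq> sets unit_borel \<and> \<Union>\<P> = {0..1}}"

definition total_variation :: "(real set \<Rightarrow> 'k::scalar_field) \<Rightarrow> real" where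
  "total_variation \<mu> = Sup (variation_sums \<mu>)"

text \<open>
  Countable additivity forces finite variation; the condition is listed only so that
  the supremum above is visibly meaningful.
\<close>

definition M_space :: "('k::scalar_field, real set \<Rightarrow> 'k) nspace" where
  "M_space =
     \<lparr>pts = {\<mu>. (\<forall>A. A \<notin> sets unit_borel \<longrightarrow> \<mu> A = 0) \<and> countably_additive_measure \<mu> \<and>
               regular_measure \<mu> \<and> bdd_above (variation_sums \<mu>)},
      smult = pw_scale, nrm = total_variation\<rparr>"

text \<open>The isometric embedding sending an integrable function to the measure with that density.\<close>

lift_definition L1_to_M :: "'k::scalar_field L1 \<Rightarrow> real set \<Rightarrow> 'k"
  is "\<lambda>f A. if A \<in> sets unit_borel then LINT x:A|lebesgue_on {0..1}. f x else 0"
proof (rule ext)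
  fix f g :: "real \<Rightarrow> 'k" and A :: "real set"
  assume *: "integrable (lebesgue_on {0..1}) f \<and> integrable (lebesgue_on {0..1}) g \<and>
             (AE x in lebesgue_on {0..1}. f x = g x)"
  have "(LINT x:A|lebesgue_on {0..1}. f x) = (LINT x:A|lebesgue_on {0..1}. g x)"
    if "A \<in> sets unit_borel"
  proof -
    from that have "A \<in> sets (lebesgue_on {0..1})"
      by (simp add: sets_restrict_space_iff)
    moreover have "AE x in lebesgue_on {0..1}.
        indicat_real A x *\<^sub>R f x = indicat_real A x *\<^sub>R g x"
      using conjunct2[OF conjunct2[OF *]] by eventually_elim (rule arg_cong)
    moreover have "(\<lambda>x. indicat_real A x *\<^sub>R h x) \<in> borel_measurable (lebesgue_on {0..1})"
      if "integrable (lebesgue_on {0..1}) h" for h :: "real \<Rightarrow> 'k"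
      by (intro borel_measurable_scaleR borel_measurable_indicator \<open>A \<in> sets (lebesgue_on {0..1})\<close>
          borel_measurable_integrable that)
    ultimately show ?thesis
      unfolding set_lebesgue_integral_def using conjunct1[OF *] conjunct1[OF conjunct2[OF *]]
      by (intro integral_cong_AE)
  qed
  then show "(if A \<in> sets unit_borel then LINT x:A|lebesgue_on {0..1}. f x else 0) =
             (if A \<in> sets unit_borel then LINT x:A|lebesgue_on {0..1}. g x else 0)"
    by simp
qed


section \<open>The weak* topology\<close>

definition simple_integral :: "(real set \<Rightarrow> 'k::scalar_field) \<Rightarrow> (real \<Rightarrow> 'k) \<Rightarrow> 'k" where
  "simple_integral \<mu> s = (\<Sum>y\<in>s ` {0..1}. y * \<mu> (s -` {y} \<inter> {0..1}))"

text \<open>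
  The integral of a function that is a uniform limit of simple Borel functions (for
  example, of a continuous function) is the common limit of the integrals along all
  sequences of simple functions that converge to it uniformly.
\<close>

definition measure_integral :: "(real set \<Rightarrow> 'k::scalar_field) \<Rightarrow> (real \<Rightarrow> 'k) \<Rightarrow> 'k" where
  "measure_integral \<mu> g =
     (THE I. \<forall>s. (\<forall>n. simple_function unit_borel (s n)) \<and> uniform_limit {0..1} s g sequentially
        \<longrightarrow> (\<lambda>n. simple_integral \<mu> (s n)) \<longlonglongrightarrow> I)"

text \<open>The coarsest topology making integration against each continuous function continuous.\<close>

definition weak_star :: "(real set \<Rightarrow> 'k::scalar_field) topology" where
  "weak_star =
     pullback_topology (pts M_space)
       (\<lambda>\<mu>. \<lambda>g\<in>{g. continuous_on {0..1} g}. measure_integral \<mu> g)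
       (product_topology (\<lambda>_. euclidean) {g. continuous_on {0..1} g})"

end

theory Submission
  imports Defs
begin

text \<open>
  The embedding of the sequence space as step functions has a contractive left inverse, given by
  the masses of the cells, both on the Lebesgue space and on the space of measures. Composing a
  projection on one side with these two maps gives a projection on the other side of no larger norm.
  This yields the equality of the three projection constants and makes minimal projections correspond
  (\<open>contractive_retract\<close>).

  The same applies to every refinement of the partition, because the copy of \<open>V\<close> over \<open>N\<close> cells is
  also the copy of its \<open>m\<close>-fold duplication over \<open>N * m\<close> cells (\<open>J_duplicate\<close>). Duplication-stability
  says that each of these finite-dimensional problems has a unique solution, so two minimal projections
  on the large space agree on the step functions over every refinement. In the Lebesgue space these
  step functions are dense (\<open>closed_subspace_with_cells\<close>), which gives uniqueness there.

  In the space of measures they are not dense in norm, but they determine what a weak* continuous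
  minimal projection does near an endpoint of a cell. On step functions such a projection averages over
  the \<open>N\<close> cells first, and so distinguishes mass just to the left of an endpoint from mass just to the
  right of it, while the weak* topology does not. Hence the minimal projection of the sequence space has
  equal values at all unit vectors, and \<open>V\<close> has dimension at most one
  (\<open>weak_star_continuous_minimal_dim\<close>).
\<close>

section \<open>Contractive retracts and minimal projections\<close>

text \<open>
  What the comparison of suprema over unit balls uses: the ball is nonempty, the norm is nonnegative
  on it, and the operations stay inside the carrier.
\<close>

definition normed_carrier :: "('k, 'a::ab_group_add) nspace \<Rightarrow> bool" where
  "normed_carrier F \<longleftrightarrow>
     0 \<in> pts F \<and> (\<forall>x\<in>pts F. \<forall>y\<in>pts F. x + y \<in> pts F) \<and>
     (\<forall>c. \<forall>x\<in>pts F. smult F c x \<in> pts F) \<and> (\<forall>x\<in>pts F. 0 \<le> nrm F x) \<and> nrm F 0 = 0"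

definition linear_contraction ::
    "('k, 'a::ab_group_add) nspace \<Rightarrow> ('k, 'b::ab_group_add) nspace \<Rightarrow> ('a \<Rightarrow> 'b) \<Rightarrow> bool" where
  "linear_contraction X Y T \<longleftrightarrow>
     T \<in> pts X \<rightarrow> pts Y \<and> (\<forall>x\<in>pts X. \<forall>y\<in>pts X. T (x + y) = T x + T y) \<and>
     (\<forall>c. \<forall>x\<in>pts X. T (smult X c x) = smult Y c (T x)) \<and> (\<forall>x\<in>pts X. nrm Y (T x) \<le> nrm X x)"

lemma linear_contraction_compose:
  assumes "linear_contraction X Y T" "linear_contraction Y Z U"
  shows "linear_contraction X Z (U \<circ> T)"
proof -
  have "nrm Z (U (T x)) \<le> nrm X x" if "x \<in> pts X" for x
    using assms that unfolding linear_contraction_def by (meson Pi_mem order_trans)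
  then show ?thesis
    using assms unfolding linear_contraction_def by (auto simp: Pi_iff)
qed

lemma bounded_projection_le_op_norm:
  assumes "normed_carrier F" "bounded_projection F E P" "x \<in> pts F" "nrm F x \<le> 1"
  shows "nrm F (P x) \<le> op_norm F P"
proof -
  obtain C where C: "\<And>y. y \<in> pts F \<Longrightarrow> nrm F (P y) \<le> C * nrm F y"
    using assms(2) unfolding bounded_projection_def bounded_on_space_def by blast
  have "bdd_above ((\<lambda>x. nrm F (P x)) ` {x \<in> pts F. nrm F x \<le> 1})"
  proof (rule bdd_aboveI2)
    fix y assume y: "y \<in> {x \<in> pts F. nrm F x \<le> 1}"
    then have "0 \<le> nrm F y" using assms(1) by (simp add: normed_carrier_def)
    have "nrm F (P y) \<le> C * nrm F y" using C y by simp
    also have "\<dots> \<le> \<bar>C\<bar> * 1"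
      using \<open>0 \<le> nrm F y\<close> y by (intro mult_mono) auto
    finally show "nrm F (P y) \<le> \<bar>C\<bar>" by simp
  qed
  then show ?thesis
    unfolding op_norm_def using assms(3,4) by (intro cSUP_upper) auto
qed

lemma op_norm_le:
  assumes "normed_carrier F" "\<And>x. x \<in> pts F \<Longrightarrow> nrm F x \<le> 1 \<Longrightarrow> nrm F (P x) \<le> c"
  shows "op_norm F P \<le> c"
  unfolding op_norm_def using assms
  by (intro cSUP_least) (auto simp: normed_carrier_def intro!: exI[of _ 0])

text \<open>
  Since \<open>S (T x) = x\<close> and both maps are contractions, \<open>T\<close> is an isometry, so \<open>X\<close> sits in \<open>F\<close> as
  the range of a projection \<open>T \<circ> S\<close> of norm at most one. Such an enlargement of the ambient space does
  not change the projection constant of a subspace of \<open>X\<close>: a projection on \<open>F\<close> can be compressed to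
  \<open>X\<close> and a projection on \<open>X\<close> can be inflated to \<open>F\<close>, and neither step increases the norm.
\<close>

locale contractive_retract =
  fixes X :: "('k, 'a::ab_group_add) nspace" and F :: "('k, 'b::ab_group_add) nspace"
    and T :: "'a \<Rightarrow> 'b" and S :: "'b \<Rightarrow> 'a"
  assumes carrier_X: "normed_carrier X" and carrier_F: "normed_carrier F"
    and T: "linear_contraction X F T" and S: "linear_contraction F X S"
    and S_T: "x \<in> pts X \<Longrightarrow> S (T x) = x"
begin

lemma T_pts: "x \<in> pts X \<Longrightarrow> T x \<in> pts F"
  and T_add: "x \<in> pts X \<Longrightarrow> y \<in> pts X \<Longrightarrow> T (x + y) = T x + T y"
  and T_smult: "x \<in> pts X \<Longrightarrow> T (smult X c x) = smult F c (T x)"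
  and T_nrm: "x \<in> pts X \<Longrightarrow> nrm F (T x) \<le> nrm X x"
  using T by (auto simp: linear_contraction_def)

lemma S_pts: "u \<in> pts F \<Longrightarrow> S u \<in> pts X"
  and S_add: "u \<in> pts F \<Longrightarrow> v \<in> pts F \<Longrightarrow> S (u + v) = S u + S v"
  and S_smult: "u \<in> pts F \<Longrightarrow> S (smult F c u) = smult X c (S u)"
  and S_nrm: "u \<in> pts F \<Longrightarrow> nrm X (S u) \<le> nrm F u"
  using S by (auto simp: linear_contraction_def)

lemma nrm_T: "x \<in> pts X \<Longrightarrow> nrm F (T x) = nrm X x"
  using T_nrm[of x] S_nrm[of "T x"] T_pts[of x] S_T[of x] by simp

lemma X_add: "x \<in> pts X \<Longrightarrow> y \<in> pts X \<Longrightarrow> x + y \<in> pts X"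
  and X_smult: "x \<in> pts X \<Longrightarrow> smult X c x \<in> pts X"
  and F_add: "u \<in> pts F \<Longrightarrow> v \<in> pts F \<Longrightarrow> u + v \<in> pts F"
  and F_smult: "u \<in> pts F \<Longrightarrow> smult F c u \<in> pts F"
  using carrier_X carrier_F by (auto simp: normed_carrier_def)

definition compress :: "('b \<Rightarrow> 'b) \<Rightarrow> 'a \<Rightarrow> 'a" where
  "compress Q = restrict (\<lambda>x. S (Q (T x))) (pts X)"

definition inflate :: "('a \<Rightarrow> 'a) \<Rightarrow> 'b \<Rightarrow> 'b" where
  "inflate P = restrict (\<lambda>u. T (P (S u))) (pts F)"

context
  fixes V :: "'a set"
  assumes V: "V \<subseteq> pts X"
begin

lemma compress_projection:
  assumes Q: "bounded_projection F (T ` V) Q"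
  shows "bounded_projection X V (compress Q)" and "op_norm X (compress Q) \<le> op_norm F Q"
proof -
  have QT: "Q (T x) \<in> T ` V" if "x \<in> pts X" for x
    using Q T_pts[OF that] by (auto simp: bounded_projection_def)
  have Qp: "Q (T x) \<in> pts F" if "x \<in> pts X" for x
    using QT[OF that] V T_pts by auto
  have Q_add: "Q (u + v) = Q u + Q v" if "u \<in> pts F" "v \<in> pts F" for u v
    using Q that by (auto simp: bounded_projection_def linear_on_space_def)
  have Q_smult: "Q (smult F c u) = smult F c (Q u)" if "u \<in> pts F" for c u
    using Q that by (auto simp: bounded_projection_def linear_on_space_def)
  obtain C where C: "\<And>u. u \<in> pts F \<Longrightarrow> nrm F (Q u) \<le> C * nrm F u"
    using Q unfolding bounded_projection_def bounded_on_space_def by blast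
  show "bounded_projection X V (compress Q)"
    unfolding bounded_projection_def
  proof (intro conjI ballI)
    show "compress Q \<in> pts X \<rightarrow>\<^sub>E V"
      unfolding compress_def
    proof (intro restrict_PiE_iff[THEN iffD2] ballI)
      fix x assume "x \<in> pts X"
      then obtain v where "v \<in> V" "Q (T x) = T v" using QT by blast
      then show "S (Q (T x)) \<in> V" using S_T V by auto
    qed
    show "linear_on_space X (compress Q)"
      unfolding linear_on_space_def compress_def
      by (simp add: X_add X_smult T_add T_smult T_pts Q_add Q_smult Qp S_add S_smult)
    have "nrm X (compress Q x) \<le> C * nrm X x" if "x \<in> pts X" for x
      using order_trans[OF S_nrm[OF Qp[OF that]] C[OF T_pts[OF that]]] that
      by (simp add: compress_def nrm_T)
    then show "bounded_on_space X (compress Q)"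
      unfolding bounded_on_space_def by blast
    fix x assume "x \<in> V"
    moreover from this have "Q (T x) = T x" using Q by (auto simp: bounded_projection_def)
    ultimately show "compress Q x = x" using V by (auto simp: compress_def S_T)
  qed
  show "op_norm X (compress Q) \<le> op_norm F Q"
  proof (rule op_norm_le[OF carrier_X])
    fix x assume x: "x \<in> pts X" "nrm X x \<le> 1"
    have "nrm X (compress Q x) \<le> nrm F (Q (T x))"
      using x Qp S_nrm by (simp add: compress_def)
    also have "\<dots> \<le> op_norm F Q"
      using x by (intro bounded_projection_le_op_norm[OF carrier_F Q]) (auto simp: T_pts nrm_T)
    finally show "nrm X (compress Q x) \<le> op_norm F Q" .
  qed
qed

lemma inflate_projection:
  assumes P: "bounded_projection X V P"
  shows "bounded_projection F (T ` V) (inflate P)" and "op_norm F (inflate P) \<le> op_norm X P"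
proof -
  have PS: "P (S u) \<in> V" if "u \<in> pts F" for u
    using P S_pts[OF that] by (auto simp: bounded_projection_def)
  have Pp: "P (S u) \<in> pts X" if "u \<in> pts F" for u
    using PS[OF that] V by auto
  have P_add: "P (x + y) = P x + P y" if "x \<in> pts X" "y \<in> pts X" for x y
    using P that by (auto simp: bounded_projection_def linear_on_space_def)
  have P_smult: "P (smult X c x) = smult X c (P x)" if "x \<in> pts X" for c x
    using P that by (auto simp: bounded_projection_def linear_on_space_def)
  obtain C where C: "\<And>x. x \<in> pts X \<Longrightarrow> nrm X (P x) \<le> C * nrm X x"
    using P unfolding bounded_projection_def bounded_on_space_def by blast
  show "bounded_projection F (T ` V) (inflate P)"
    unfolding bounded_projection_def
  proof (intro conjI ballI)
    show "inflate P \<in> pts F \<rightarrow>\<^sub>E T ` V"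
      unfolding inflate_def using PS by auto
    show "linear_on_space F (inflate P)"
      unfolding linear_on_space_def inflate_def
      by (simp add: F_add F_smult T_add T_smult S_pts P_add P_smult Pp S_add S_smult)
    have "nrm F (inflate P u) \<le> \<bar>C\<bar> * nrm F u" if u: "u \<in> pts F" for u
    proof -
      have "0 \<le> nrm X (S u)" using carrier_X S_pts[OF u] by (simp add: normed_carrier_def)
      have "nrm F (inflate P u) \<le> C * nrm X (S u)"
        using C[OF S_pts[OF u]] u Pp by (simp add: inflate_def nrm_T)
      also have "\<dots> \<le> \<bar>C\<bar> * nrm F u"
        using S_nrm[OF u] \<open>0 \<le> nrm X (S u)\<close> by (intro mult_mono) auto
      finally show ?thesis .
    qed
    then show "bounded_on_space F (inflate P)"
      unfolding bounded_on_space_def by blast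
    fix u assume "u \<in> T ` V"
    then obtain x where "x \<in> V" "u = T x" by blast
    moreover from this have "P x = x" using P by (auto simp: bounded_projection_def)
    ultimately show "inflate P u = u" using V by (auto simp: inflate_def S_T T_pts)
  qed
  show "op_norm F (inflate P) \<le> op_norm X P"
  proof (rule op_norm_le[OF carrier_F])
    fix u assume u: "u \<in> pts F" "nrm F u \<le> 1"
    have "nrm F (inflate P u) = nrm X (P (S u))"
      using u Pp nrm_T by (simp add: inflate_def)
    also have "\<dots> \<le> op_norm X P"
      using u S_nrm[of u] by (intro bounded_projection_le_op_norm[OF carrier_X P]) (auto simp: S_pts)
    finally show "nrm F (inflate P u) \<le> op_norm X P" .
  qed
qed

lemma proj_const_eq: "proj_const F (T ` V) = proj_const X V"
proof (rule antisym)
  show "proj_const F (T ` V) \<le> proj_const X V"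
    unfolding proj_const_def using inflate_projection
    by (intro INF_mono) (auto intro!: bexI[where x = "inflate _"])
  show "proj_const X V \<le> proj_const F (T ` V)"
    unfolding proj_const_def using compress_projection
    by (intro INF_mono) (auto intro!: bexI[where x = "compress _"])
qed

lemma minimal_projectionI:
  assumes "bounded_projection X V P" "ereal (op_norm X P) \<le> proj_const X V"
  shows "minimal_projection X V P"
  using assms unfolding minimal_projection_def proj_const_def
  by (auto intro!: antisym INF_lower)

lemma compress_minimal:
  assumes "minimal_projection F (T ` V) Q"
  shows "minimal_projection X V (compress Q)"
proof (rule minimal_projectionI)
  have Q: "bounded_projection F (T ` V) Q" and eq: "ereal (op_norm F Q) = proj_const X V"
    using assms by (auto simp: minimal_projection_def proj_const_eq)
  show "bounded_projection X V (compress Q)"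
    using Q by (rule compress_projection)
  show "ereal (op_norm X (compress Q)) \<le> proj_const X V"
    using compress_projection(2)[OF Q] by (simp flip: eq)
qed

lemma inflate_minimal:
  assumes "minimal_projection X V P"
  shows "minimal_projection F (T ` V) (inflate P)"
proof -
  have P: "bounded_projection X V P" and eq: "ereal (op_norm X P) = proj_const X V"
    using assms by (auto simp: minimal_projection_def)
  have "ereal (op_norm F (inflate P)) \<le> proj_const F (T ` V)"
    using inflate_projection(2)[OF P] by (simp add: proj_const_eq flip: eq)
  then show ?thesis
    using inflate_projection(1)[OF P] unfolding minimal_projection_def proj_const_def
    by (auto intro!: antisym INF_lower)
qed

text \<open>
  Both projections have values in \<open>T ` V\<close>, where \<open>S\<close> is injective, so they are determined on the range
  of \<open>T\<close> by their compressions, which are minimal projections on \<open>X\<close> and hence equal.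
\<close>

lemma minimal_projections_agree:
  assumes unique: "\<exists>!P. minimal_projection X V P"
    and Q: "minimal_projection F (T ` V) Q" and Q': "minimal_projection F (T ` V) Q'"
    and x: "x \<in> pts X"
  shows "Q (T x) = Q' (T x)"
proof -
  have "compress Q = compress Q'"
    using unique compress_minimal[OF Q] compress_minimal[OF Q'] by blast
  then have "S (Q (T x)) = S (Q' (T x))"
    using x by (auto simp: compress_def dest: fun_cong[of _ _ x])
  moreover have "Q (T x) \<in> T ` V" "Q' (T x) \<in> T ` V"
    using Q Q' T_pts[OF x] by (auto simp: minimal_projection_def bounded_projection_def)
  ultimately show ?thesis
    using V S_T by (auto simp: subset_iff)
qed

end

end

section \<open>Partitions into cells\<close>

abbreviation unit_lebesgue :: "real measure" where
  "unit_lebesgue \<equiv> lebesgue_on {0..1}"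

lemma sets_unit_borel_lebesgue: "A \<in> sets unit_borel \<Longrightarrow> A \<in> sets unit_lebesgue"
  by (auto simp: sets_restrict_space_iff)

lemma cell_bounds:
  assumes "t \<in> cell N j"
  shows "real j / real N \<le> t" "t < real (Suc j) / real N \<or> Suc j = N \<and> t = 1"
  using assms by (auto simp: cell_def split: if_splits)

lemma cell_width:
  assumes "t \<in> cell N j"
  shows "t \<le> real j / real N + 1 / real N"
proof -
  have eq: "real j / real N + 1 / real N = real (Suc j) / real N"
    by (simp add: add_divide_distrib)
  consider "t < real (Suc j) / real N" | "Suc j = N" "t = 1"
    using cell_bounds(2)[OF assms] by blast
  then show ?thesis
  proof cases
    case 2
    then have "real (Suc j) / real N = 1" by auto
    then show ?thesis unfolding eq using 2 by simp
  qed (simp only: eq less_imp_le)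
qed

lemma cell_subset:
  assumes "j < N"
  shows "cell N j \<subseteq> {0..1}"
proof
  fix t assume t: "t \<in> cell N j"
  have "0 \<le> real j / real N" by simp
  moreover have "real (Suc j) / real N \<le> 1" using assms by (simp add: field_simps)
  ultimately have "0 \<le> t" "t \<le> 1"
    using cell_bounds[OF t] by linarith+
  then show "t \<in> {0..1}" by simp
qed

lemma cell_sets: "j < N \<Longrightarrow> cell N j \<in> sets unit_borel"
  using cell_subset[of j N] by (simp add: sets_restrict_space_iff) (simp add: cell_def)

text \<open>
  The point 1 belongs to the last cell, which is closed, whereas the floor would place it in a
  nonexistent cell of index \<open>N\<close>; hence the case distinction.
\<close>

lemma cell_eq_floor:
  assumes "t \<in> cell N j" "j < N"
  shows "j = (if t = 1 then N - 1 else nat \<lfloor>t * real N\<rfloor>)"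
proof (cases "t = 1")
  case True
  then show ?thesis
    using assms by (auto simp: cell_def field_simps split: if_splits)
next
  case False
  then have "real j \<le> t * real N" "t * real N < real j + 1"
    using cell_bounds[OF assms(1)] assms(2) by (auto simp: field_simps)
  then have "\<lfloor>t * real N\<rfloor> = int j" by (intro floor_unique) auto
  then show ?thesis using False by simp
qed

lemma cell_unique: "t \<in> cell N i \<Longrightarrow> t \<in> cell N j \<Longrightarrow> i < N \<Longrightarrow> j < N \<Longrightarrow> i = j"
  using cell_eq_floor by metis

lemma cell_cover:
  assumes "t \<in> {0..1}" "0 < N"
  obtains j where "j < N" "t \<in> cell N j"
proof (cases "t = 1")
  case True
  with assms that[of "N - 1"] show ?thesis by (auto simp: cell_def)
next
  case False
  define j where "j = nat \<lfloor>t * real N\<rfloor>"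
  have "0 \<le> t * real N" using assms by simp
  then have j: "real j \<le> t * real N" "t * real N < real j + 1"
    unfolding j_def by (auto simp: of_nat_nat)
  have "t * real N < real N" using assms False by simp
  then have "j < N" using j by linarith
  moreover have "t \<in> cell N j"
    using assms j by (auto simp: cell_def field_simps)
  ultimately show ?thesis by (rule that)
qed

lemma cell_refine:
  assumes "i < N * m"
  shows "cell (N * m) i \<subseteq> cell N (i div m)"
proof
  fix t assume t: "t \<in> cell (N * m) i"
  have m: "0 < m" and N: "0 < N" using assms by (auto intro: gr0I)
  have j: "i div m < N" using assms m by (simp add: less_mult_imp_div_less)
  have lo: "i div m * m \<le> i" and up: "Suc i \<le> Suc (i div m) * m"
    using m by (simp, metis Suc_leI div_less_iff_less_mult lessI mult.commute)
  have lo': "real (i div m) * real m \<le> real i" using lo by (metis of_nat_mono of_nat_mult)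
  have up': "real (Suc i) \<le> real (Suc (i div m)) * real m"
    using up by (metis of_nat_mono of_nat_mult)
  have "real (i div m) / real N \<le> real i / real (N * m)"
    using lo' m N by (simp add: field_simps)
  then have 1: "real (i div m) / real N \<le> t" using cell_bounds(1)[OF t] by linarith
  have 2: "real (Suc i) / real (N * m) \<le> real (Suc (i div m)) / real N"
    using up' m N by (simp add: field_simps del: of_nat_Suc)
  \<comment> \<open>The point 1 lies in the last fine cell only, which is part of the last coarse one.\<close>
  consider "t < real (Suc (i div m)) / real N" | "Suc i = N * m" "t = 1"
    using cell_bounds(2)[OF t] 2 by force
  then show "t \<in> cell N (i div m)"
  proof cases
    case 1
    then show ?thesis
      using \<open>real (i div m) / real N \<le> t\<close> j N by (auto simp: cell_def)
  next
    case 2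
    then have "N * m \<le> Suc (i div m) * m" using up by simp
    then have "N \<le> Suc (i div m)" using m by (simp only: mult_le_cancel2)
    then have "Suc (i div m) = N" using j by simp
    then show ?thesis using 2 1 by (auto simp: cell_def)
  qed
qed

lemma measure_cell: "j < N \<Longrightarrow> measure unit_lebesgue (cell N j) = 1 / real N"
proof -
  assume j: "j < N"
  have "measure unit_lebesgue (cell N j) = measure lebesgue (cell N j)"
    using cell_subset[OF j] by (simp add: measure_restrict_space)
  also have "\<dots> = 1 / real N"
    using j by (auto simp: cell_def measure_lborel_Ico field_simps)
  finally show ?thesis .
qed

lemma sum_indicator_cells:
  fixes c :: "nat \<Rightarrow> 'k::scalar_field"
  assumes "t \<in> cell N j" "j < N"
  shows "(\<Sum>i<N. c i * indicator (cell N i) t) = c j"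
proof -
  have "(\<Sum>i<N. c i * indicator (cell N i) t) = (\<Sum>i<N. if i = j then c j else 0)"
  proof (rule sum.cong[OF refl])
    fix i assume "i \<in> {..<N}"
    then have "t \<in> cell N i \<longleftrightarrow> i = j"
      using cell_unique[of t N i j] assms by blast
    then show "c i * indicator (cell N i) t = (if i = j then c j else 0)"
      by (simp add: indicator_def)
  qed
  then show ?thesis using assms(2) by simp
qed

lemma disjoint_family_cells: "disjoint_family_on (cell N) {..<N}"
  unfolding disjoint_family_on_def using cell_unique by blast

lemma UN_cells:
  assumes "0 < N"
  shows "(\<Union>j<N. cell N j) = {0..1}"
proof (intro equalityI subsetI)
  fix t :: real assume "t \<in> {0..1}"
  then obtain j where "j < N" "t \<in> cell N j" using assms by (rule cell_cover)
  then show "t \<in> (\<Union>j<N. cell N j)" by blast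
qed (use cell_subset in blast)

section \<open>Integrable functions and their classes\<close>

lemma finite_measure_unit_lebesgue: "finite_measure unit_lebesgue"
  by (rule finite_measure_lebesgue_on) simp

text \<open>
  Every class has an integrable representative; with the rules that follow, computations in the
  quotient become computations with representatives.
\<close>

lemma L1_cases:
  obtains f where "integrable unit_lebesgue f" "u = abs_L1 f"
  using Quotient_rep_reflp[OF Quotient_L1, of u] Quotient_abs_rep[OF Quotient_L1, of u] by metis

context
  fixes f g :: "real \<Rightarrow> 'k::scalar_field"
  assumes f: "integrable unit_lebesgue f"
begin

lemma abs_L1_scale: "L1_scale c (abs_L1 f) = abs_L1 (\<lambda>t. c * f t)"
  using f by (simp add: L1_scale.abs_eq)

lemma L1_norm_abs: "L1_norm (abs_L1 f) = (\<integral>t. norm (f t) \<partial>unit_lebesgue)"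
  using f by (simp add: L1_norm.abs_eq)

lemma L1_to_M_abs:
  "A \<in> sets unit_borel \<Longrightarrow> L1_to_M (abs_L1 f) A = (LINT t:A|unit_lebesgue. f t)"
  using f by (simp add: L1_to_M.abs_eq)

context
  assumes g: "integrable unit_lebesgue g"
begin

lemma abs_L1_add: "abs_L1 f + abs_L1 g = abs_L1 (\<lambda>t. f t + g t)"
  using f g by (simp add: plus_L1.abs_eq)

lemma abs_L1_diff: "abs_L1 f - abs_L1 g = abs_L1 (\<lambda>t. f t - g t)"
  using f g by (simp add: minus_L1.abs_eq)

lemma abs_L1_cong: "(AE t in unit_lebesgue. f t = g t) \<Longrightarrow> abs_L1 f = abs_L1 g"
  using f g Quotient_L1 by (metis (mono_tags, lifting) Quotient_rel_abs)

end
end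

lemma abs_L1_zero: "abs_L1 (\<lambda>_. 0) = 0"
  by (simp add: zero_L1_def)

lemma L1_norm_zero: "L1_norm 0 = 0"
  by transfer simp

lemma L1_norm_nonneg: "0 \<le> L1_norm u"
  by (cases u rule: L1_cases) (simp add: L1_norm_abs)

lemma L1_norm_add: "L1_norm (u + v) \<le> L1_norm u + L1_norm v"
proof -
  obtain f where f: "integrable unit_lebesgue f" "u = abs_L1 f" by (rule L1_cases)
  obtain g where g: "integrable unit_lebesgue g" "v = abs_L1 g" by (rule L1_cases)
  have "(\<integral>t. norm (f t + g t) \<partial>unit_lebesgue)
      \<le> (\<integral>t. norm (f t) + norm (g t) \<partial>unit_lebesgue)"
    using f g by (intro integral_mono) (auto intro: norm_triangle_ineq)
  then show ?thesis
    using f g by (simp add: abs_L1_add L1_norm_abs)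
qed

lemma L1_norm_scale: "L1_norm (L1_scale c u) = norm c * L1_norm u"
  by (cases u rule: L1_cases) (simp add: abs_L1_scale L1_norm_abs norm_mult)

lemma L1_norm_sum: "L1_norm (\<Sum>i\<in>I. u i) \<le> (\<Sum>i\<in>I. L1_norm (u i))"
  by (induction I rule: infinite_finite_induct)
     (auto simp: L1_norm_zero intro: order_trans[OF L1_norm_add])

lemma L1_norm_eq_0: "L1_norm u = 0 \<Longrightarrow> u = 0"
proof -
  assume 0: "L1_norm u = 0"
  obtain f where f: "integrable unit_lebesgue f" "u = abs_L1 f" by (rule L1_cases)
  have "AE t in unit_lebesgue. norm (f t) = 0"
    using 0 f by (subst integral_nonneg_eq_0_iff_AE[symmetric]) (auto simp: L1_norm_abs)
  then have "abs_L1 f = abs_L1 (\<lambda>_. 0)"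
    using f by (intro abs_L1_cong) auto
  then show ?thesis using f by (simp add: abs_L1_zero)
qed

lemma L1_norm_minus: "L1_norm (- u) = L1_norm u"
  by transfer simp

lemma L1_scale_right_distrib: "L1_scale c (u + v) = L1_scale c u + L1_scale c v"
  and L1_scale_left_distrib: "L1_scale (c + d) u = L1_scale c u + L1_scale d u"
  and L1_scale_scale: "L1_scale c (L1_scale d u) = L1_scale (c * d) u"
  and L1_scale_zero: "L1_scale c 0 = 0"
  by (transfer; auto simp: algebra_simps)+

lemma L1_scale_sum: "L1_scale c (\<Sum>i\<in>I. u i) = (\<Sum>i\<in>I. L1_scale c (u i))"
  by (induction I rule: infinite_finite_induct)
     (auto simp: L1_scale_zero L1_scale_right_distrib)

lemma integrable_indicator_unit:
  assumes "A \<in> sets unit_lebesgue"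
  shows "integrable unit_lebesgue (indicator A :: real \<Rightarrow> 'k::scalar_field)"
  using assms finite_measure_unit_lebesgue
  by (intro finite_measure.integrable_const_bound[where B = 1] AE_I2 borel_measurable_indicator)
     (auto simp: indicator_def)

lemma integrable_cell:
  "j < N \<Longrightarrow> integrable unit_lebesgue (\<lambda>t. of_nat N * indicator (cell N j) t :: 'k::scalar_field)"
  by (intro integrable_mult_right integrable_indicator_unit sets_unit_borel_lebesgue cell_sets)

lemma cell_density_abs:
  "(cell_density N j :: 'k::scalar_field L1) = abs_L1 (\<lambda>t. of_nat N * indicator (cell N j) t)"
  by (simp add: cell_density_def)

lemma integrable_step:
  fixes x :: "nat \<Rightarrow> 'k::scalar_field"
  shows "integrable unit_lebesgue (\<lambda>t. \<Sum>j<N. x j * (of_nat N * indicator (cell N j) t))"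
  by (intro Bochner_Integration.integrable_sum integrable_mult_right integrable_cell) auto

lemma J_abs:
  fixes x :: "nat \<Rightarrow> 'k::scalar_field"
  shows "J N x = abs_L1 (\<lambda>t. \<Sum>j<N. x j * (of_nat N * indicator (cell N j) t))"
proof -
  have "(\<Sum>j<n. L1_scale (x j) (cell_density N j)) =
      abs_L1 (\<lambda>t. \<Sum>j<n. x j * (of_nat N * indicator (cell N j) t))" if "n \<le> N" for n
    using that
  proof (induction n)
    case 0
    then show ?case by (simp add: abs_L1_zero)
  next
    case (Suc n)
    then show ?case
      by (auto simp: cell_density_abs abs_L1_scale integrable_cell
          intro!: abs_L1_add Bochner_Integration.integrable_sum integrable_mult_right integrable_cell)
  qed
  then show ?thesis by (simp add: J_def)
qed

lemma L1_norm_cell_density: "j < N \<Longrightarrow> L1_norm (cell_density N j :: 'k::scalar_field L1) = 1"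
proof -
  assume j: "j < N"
  have "L1_norm (cell_density N j :: 'k L1)
      = (\<integral>t. real N * indicator (cell N j) t \<partial>unit_lebesgue)"
    unfolding cell_density_abs
    by (subst L1_norm_abs[OF integrable_cell[OF j]])
       (auto intro!: Bochner_Integration.integral_cong simp: norm_mult indicator_def)
  also have "\<dots> = real N * measure unit_lebesgue (cell N j)"
    using sets_unit_borel_lebesgue[OF cell_sets[OF j]] cell_subset[OF j] by (simp add: Int_absorb2)
  finally show ?thesis using j by (simp add: measure_cell)
qed

text \<open>
  On the cell of index \<open>i\<close> of the finer partition the left-hand side is \<open>N * m\<close> times the duplicated
  coordinate \<open>x (i div m) / m\<close>, that is \<open>N * x (i div m)\<close>; this cell lies in the coarse cell of index
  \<open>i div m\<close>, where the right-hand side has the same value. So the piecewise constant copy of a subspace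
  is also the copy of each of its duplications.
\<close>

lemma J_duplicate:
  fixes x :: "nat \<Rightarrow> 'k::scalar_field"
  assumes "1 \<le> m" "1 \<le> N"
  shows "J (N * m) (duplicate m x) = J N x"
  unfolding J_abs
proof (rule abs_L1_cong[OF integrable_step integrable_step], rule AE_I2)
  fix t assume "t \<in> space unit_lebesgue"
  then obtain i where i: "i < N * m" "t \<in> cell (N * m) i"
    using assms cell_cover[of t "N * m"] by auto
  have j: "i div m < N" using i by (simp add: less_mult_imp_div_less)
  have t: "t \<in> cell N (i div m)" using i cell_refine by blast
  show "(\<Sum>j<N * m. duplicate m x j * (of_nat (N * m) * indicator (cell (N * m) j) t)) =
      (\<Sum>j<N. x j * (of_nat N * indicator (cell N j) t))"
    using sum_indicator_cells[OF i(2,1), of "\<lambda>j. duplicate m x j * of_nat (N * m)"]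
      sum_indicator_cells[OF t j, of "\<lambda>j. x j * of_nat N"] assms
    by (simp add: mult.assoc duplicate_def)
qed

lemma duplicate_pts: "1 \<le> m \<Longrightarrow> x \<in> pts (ell1 N) \<Longrightarrow> duplicate m x \<in> pts (ell1 (N * m))"
  by (auto simp: ell1_def duplicate_def less_eq_div_iff_mult_less_eq)

lemma L1_scale_one: "L1_scale 1 u = u"
  and L1_scale_zero_left: "L1_scale 0 u = 0"
  by (transfer; simp)+

lemma J_unit:
  assumes "i < N"
  shows "J N (\<lambda>j. if j = i then 1 else 0) = cell_density N i"
proof -
  have "J N (\<lambda>j. if j = i then 1 else 0) = (\<Sum>j<N. if j = i then cell_density N i else 0)"
    unfolding J_def by (intro sum.cong refl) (simp add: L1_scale_one L1_scale_zero_left)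
  then show ?thesis using assms by simp
qed

lemma J_diff: "J N (x - y) = J N x - J N y"
proof -
  have "L1_scale (a - b) u = L1_scale a u - L1_scale b u" for a b and u :: "'a L1"
    by transfer (simp add: algebra_simps)
  then show ?thesis by (simp add: J_def sum_subtractf)
qed

lemma normed_carrier_ell1: "normed_carrier (ell1 N)"
  by (auto simp: normed_carrier_def ell1_def pw_scale_def intro!: sum_nonneg)

lemma normed_carrier_L1: "normed_carrier L1_space"
  by (auto simp: normed_carrier_def L1_space_def L1_norm_nonneg L1_norm_zero)

lemma linear_contraction_J: "linear_contraction (ell1 N) L1_space (J N)"
proof -
  have "L1_norm (J N x) \<le> (\<Sum>j<N. norm (x j))" for x :: "nat \<Rightarrow> 'k::scalar_field"
    unfolding J_def
    by (rule order_trans[OF L1_norm_sum])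
       (auto intro!: sum_mono simp: L1_norm_scale L1_norm_cell_density)
  then show ?thesis
    by (auto simp: linear_contraction_def ell1_def L1_space_def J_def pw_scale_def
        L1_scale_left_distrib sum.distrib L1_scale_sum L1_scale_scale)
qed

section \<open>Measures\<close>

definition borel_partition :: "real set set \<Rightarrow> bool" where
  "borel_partition \<P> \<longleftrightarrow> finite \<P> \<and> disjoint \<P> \<and> \<P> \<subseteq> sets unit_borel \<and> \<Union>\<P> = {0..1}"

lemma variation_sums_partition:
  "variation_sums \<mu> = {\<Sum>B\<in>\<P>. norm (\<mu> B) |\<P>. borel_partition \<P>}"
  by (simp add: variation_sums_def borel_partition_def)

lemma variation_le:
  assumes "bdd_above (variation_sums \<mu>)" "borel_partition \<P>"
  shows "(\<Sum>B\<in>\<P>. norm (\<mu> B)) \<le> total_variation \<mu>"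
  unfolding total_variation_def
  using assms by (intro cSup_upper) (auto simp: variation_sums_partition)

lemma total_variation_le:
  assumes "\<And>\<P>. borel_partition \<P> \<Longrightarrow> (\<Sum>B\<in>\<P>. norm (\<mu> B)) \<le> c"
  shows "bdd_above (variation_sums \<mu>)" "total_variation \<mu> \<le> c"
proof -
  have "borel_partition {{0..1}}"
    by (auto simp: borel_partition_def sets_restrict_space_iff)
  then have "variation_sums \<mu> \<noteq> {}"
    by (auto simp: variation_sums_partition)
  then show "total_variation \<mu> \<le> c"
    unfolding total_variation_def using assms
    by (intro cSup_least) (auto simp: variation_sums_partition)
  show "bdd_above (variation_sums \<mu>)"
    using assms by (intro bdd_aboveI[of _ c]) (auto simp: variation_sums_partition)
qed

lemma zero_M:
  "(0 :: real set \<Rightarrow> 'k::scalar_field) \<in> pts M_space"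
  "total_variation (0 :: real set \<Rightarrow> 'k) = 0"
proof -
  have *: "variation_sums (0 :: real set \<Rightarrow> 'k) \<subseteq> {0}"
    by (auto simp: variation_sums_partition)
  have "borel_partition {{0..1}}"
    by (auto simp: borel_partition_def sets_restrict_space_iff)
  then have "variation_sums (0 :: real set \<Rightarrow> 'k) = {0}"
    using * by (auto simp: variation_sums_partition)
  then show "total_variation (0 :: real set \<Rightarrow> 'k) = 0"
    by (simp add: total_variation_def)
  have "regular_measure (0 :: real set \<Rightarrow> 'k)"
    unfolding regular_measure_def
    by (intro ballI allI impI exI[of _ "{}"] exI[of _ UNIV]) auto
  then show "(0 :: real set \<Rightarrow> 'k) \<in> pts M_space"
    by (simp add: M_space_def countably_additive_measure_def * bdd_above_mono[OF _ *])
qed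

lemma regular_measure_add:
  assumes \<mu>: "regular_measure \<mu>" and \<nu>: "regular_measure \<nu>"
  shows "regular_measure (\<mu> + \<nu>)"
  unfolding regular_measure_def
proof (intro ballI allI impI)
  fix A :: "real set" and e :: real
  assume A: "A \<in> sets unit_borel" and e: "0 < e"
  have e2: "0 < e / 2" using e by simp
  obtain F G where FG: "closed F" "open G" "F \<subseteq> A" "A \<subseteq> G"
      "\<And>B. B \<in> sets unit_borel \<Longrightarrow> B \<subseteq> G - F \<Longrightarrow> norm (\<mu> B) < e / 2"
    using \<mu> A e2 unfolding regular_measure_def by meson
  obtain F' G' where FG': "closed F'" "open G'" "F' \<subseteq> A" "A \<subseteq> G'"
      "\<And>B. B \<in> sets unit_borel \<Longrightarrow> B \<subseteq> G' - F' \<Longrightarrow> norm (\<nu> B) < e / 2"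
    using \<nu> A e2 unfolding regular_measure_def by meson
  have "norm ((\<mu> + \<nu>) B) < e" if "B \<in> sets unit_borel" "B \<subseteq> G \<inter> G' - (F \<union> F')" for B
  proof -
    have "norm (\<mu> B) < e / 2" "norm (\<nu> B) < e / 2"
      using that FG(5)[of B] FG'(5)[of B] by blast+
    then show ?thesis using norm_triangle_ineq[of "\<mu> B" "\<nu> B"] by simp
  qed
  then show "\<exists>F G. closed F \<and> open G \<and> F \<subseteq> A \<and> A \<subseteq> G \<and>
      (\<forall>B\<in>sets unit_borel. B \<subseteq> G - F \<longrightarrow> norm ((\<mu> + \<nu>) B) < e)"
    using FG FG' by (intro exI[of _ "F \<union> F'"] exI[of _ "G \<inter> G'"]) auto
qed

lemma regular_measure_scale:
  assumes \<mu>: "regular_measure \<mu>"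
  shows "regular_measure (pw_scale c \<mu>)"
  unfolding regular_measure_def
proof (intro ballI allI impI)
  fix A :: "real set" and e :: real
  assume A: "A \<in> sets unit_borel" and e: "0 < e"
  have pos: "0 < norm c + 1" by (simp add: add_nonneg_pos)
  then have e': "0 < e / (norm c + 1)" using e by simp
  obtain F G where FG: "closed F" "open G" "F \<subseteq> A" "A \<subseteq> G"
      "\<And>B. B \<in> sets unit_borel \<Longrightarrow> B \<subseteq> G - F \<Longrightarrow> norm (\<mu> B) < e / (norm c + 1)"
    using \<mu> A e' unfolding regular_measure_def by meson
  have "norm (pw_scale c \<mu> B) < e" if "B \<in> sets unit_borel" "B \<subseteq> G - F" for B
  proof -
    have "norm (pw_scale c \<mu> B) \<le> (norm c + 1) * norm (\<mu> B)"
      by (simp add: pw_scale_def norm_mult mult_right_mono)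
    also have "\<dots> < e"
      using FG(5)[OF that] pos by (simp add: pos_less_divide_eq mult.commute)
    finally show ?thesis .
  qed
  then show "\<exists>F G. closed F \<and> open G \<and> F \<subseteq> A \<and> A \<subseteq> G \<and>
      (\<forall>B\<in>sets unit_borel. B \<subseteq> G - F \<longrightarrow> norm (pw_scale c \<mu> B) < e)"
    using FG by (intro exI[of _ F] exI[of _ G]) auto
qed

lemma countably_additive_measure_add:
  "countably_additive_measure \<mu> \<Longrightarrow> countably_additive_measure \<nu> \<Longrightarrow>
    countably_additive_measure (\<mu> + \<nu>)"
  unfolding countably_additive_measure_def plus_fun_def by (intro allI impI sums_add) auto

lemma countably_additive_measure_scale:
  "countably_additive_measure \<mu> \<Longrightarrow> countably_additive_measure (pw_scale c \<mu>)"
  unfolding countably_additive_measure_def pw_scale_def by (intro allI impI sums_mult) auto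

lemma normed_carrier_M: "normed_carrier (M_space :: ('k::scalar_field, real set \<Rightarrow> 'k) nspace)"
  unfolding normed_carrier_def
proof (intro conjI ballI allI)
  fix \<mu> \<nu> :: "real set \<Rightarrow> 'k" and c :: 'k
  assume \<mu>: "\<mu> \<in> pts M_space"
  have "borel_partition {{0..1}}"
    by (auto simp: borel_partition_def sets_restrict_space_iff)
  then have "norm (\<mu> {0..1}) \<le> total_variation \<mu>"
    using variation_le[of \<mu> "{{0..1}}"] \<mu> by (simp add: M_space_def)
  then show "0 \<le> nrm M_space \<mu>"
    by (simp add: M_space_def) (meson norm_ge_zero order_trans)
  have "(\<Sum>B\<in>\<P>. norm (pw_scale c \<mu> B)) \<le> norm c * total_variation \<mu>"
    if "borel_partition \<P>" for \<P>
    using variation_le[OF _ that, of \<mu>] \<mu>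
    by (auto simp: M_space_def pw_scale_def norm_mult intro: mult_left_mono simp flip: sum_distrib_left)
  then have "bdd_above (variation_sums (pw_scale c \<mu>))"
    by (rule total_variation_le)
  with \<mu> show "smult M_space c \<mu> \<in> pts M_space"
    by (simp add: M_space_def regular_measure_scale countably_additive_measure_scale)
       (simp add: pw_scale_def)
  assume \<nu>: "\<nu> \<in> pts M_space"
  have "(\<Sum>B\<in>\<P>. norm ((\<mu> + \<nu>) B)) \<le> total_variation \<mu> + total_variation \<nu>"
    if "borel_partition \<P>" for \<P>
  proof -
    have "(\<Sum>B\<in>\<P>. norm ((\<mu> + \<nu>) B)) \<le> (\<Sum>B\<in>\<P>. norm (\<mu> B)) + (\<Sum>B\<in>\<P>. norm (\<nu> B))"
      by (simp flip: sum.distrib add: sum_mono norm_triangle_ineq)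
    then show ?thesis
      using variation_le[OF _ that, of \<mu>] variation_le[OF _ that, of \<nu>] \<mu> \<nu>
      by (simp add: M_space_def)
  qed
  then have "bdd_above (variation_sums (\<mu> + \<nu>))"
    by (rule total_variation_le)
  with \<mu> \<nu> show "\<mu> + \<nu> \<in> pts M_space"
    by (simp add: M_space_def regular_measure_add countably_additive_measure_add)
qed (use zero_M in \<open>auto simp: M_space_def\<close>)

context
  fixes f :: "real \<Rightarrow> 'k::scalar_field"
  assumes f: "integrable unit_lebesgue f"
begin

lemma set_integrable_unit: "A \<in> sets unit_borel \<Longrightarrow> set_integrable unit_lebesgue A f"
  unfolding set_integrable_def using f by (intro integrable_mult_indicator sets_unit_borel_lebesgue)

lemma norm_set_integral_le:
  assumes "A \<in> sets unit_borel"
  shows "norm (LINT t:A|unit_lebesgue. f t) \<le> (LINT t:A|unit_lebesgue. norm (f t))"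
  unfolding set_lebesgue_integral_def
  using integral_norm_bound[of unit_lebesgue "\<lambda>t. indicator A t *\<^sub>R f t"] by simp

lemma countably_additive_L1_to_M: "countably_additive_measure (L1_to_M (abs_L1 f))"
  unfolding countably_additive_measure_def
proof (intro allI impI)
  fix A :: "nat \<Rightarrow> real set"
  assume A: "range A \<subseteq> sets unit_borel \<and> disjoint_family A"
  then have Ai: "A i \<in> sets unit_borel" for i by auto
  have U: "(\<Union>i. A i) \<in> sets unit_borel" using Ai by blast
  have partial: "(\<Union>i<n. A i) \<in> sets unit_borel" for n using Ai by blast
  have sum_eq: "(\<Sum>i<n. L1_to_M (abs_L1 f) (A i))
      = (\<integral>t. indicator (\<Union>i<n. A i) t *\<^sub>R f t \<partial>unit_lebesgue)" for n
    using set_integral_finite_Union[of "{..<n}" A unit_lebesgue f] A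
    by (simp add: L1_to_M_abs[OF f] Ai set_integrable_unit sets_unit_borel_lebesgue
        disjoint_family_on_def set_lebesgue_integral_def)
  have "(\<lambda>n. \<integral>t. indicator (\<Union>i<n. A i) t *\<^sub>R f t \<partial>unit_lebesgue)
      \<longlonglongrightarrow> (\<integral>t. indicator (\<Union>i. A i) t *\<^sub>R f t \<partial>unit_lebesgue)"
  proof (rule integral_dominated_convergence[where w = "\<lambda>t. norm (f t)"])
    show "AE t in unit_lebesgue. (\<lambda>n. indicator (\<Union>i<n. A i) t *\<^sub>R f t)
        \<longlonglongrightarrow> indicator (\<Union>i. A i) t *\<^sub>R f t"
      by (intro AE_I2 tendsto_scaleR tendsto_const LIMSEQ_indicator_UN)
    show "(\<lambda>t. indicator (\<Union>i. A i) t *\<^sub>R f t) \<in> borel_measurable unit_lebesgue"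
      "(\<lambda>t. indicator (\<Union>i<n. A i) t *\<^sub>R f t) \<in> borel_measurable unit_lebesgue" for n
      using f by (intro borel_measurable_scaleR borel_measurable_indicator
          sets_unit_borel_lebesgue U partial borel_measurable_integrable; assumption)+
    show "integrable unit_lebesgue (\<lambda>t. norm (f t))" using f by simp
    show "AE t in unit_lebesgue. norm (indicator (\<Union>i<n. A i) t *\<^sub>R f t) \<le> norm (f t)" for n
      by (rule AE_I2) (simp add: indicator_def)
  qed
  then show "(\<lambda>i. L1_to_M (abs_L1 f) (A i)) sums L1_to_M (abs_L1 f) (\<Union>i. A i)"
    unfolding sums_def sum_eq L1_to_M_abs[OF f U] set_lebesgue_integral_def .
qed

text \<open>
  The variation of this measure on a set is at most the integral of the norm of \<open>f\<close> over it. These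
  integrals form a finite Borel measure on the line, which is inner and outer regular.
\<close>

lemma regular_L1_to_M: "regular_measure (L1_to_M (abs_L1 f))"
  unfolding regular_measure_def
proof (intro ballI allI impI)
  fix A :: "real set" and e :: real
  assume A: "A \<in> sets unit_borel" and e: "0 < e"
  \<comment> \<open>Regularity concerns measures on the Borel sets of the whole line, hence the image measure.\<close>
  define M where "M = distr (density unit_lebesgue (\<lambda>t. ennreal (norm (f t)))) borel (\<lambda>t. t)"
  have [measurable]: "f \<in> borel_measurable unit_lebesgue" using f by simp
  have id: "(\<lambda>t. t) \<in> unit_lebesgue \<rightarrow>\<^sub>M borel"
    by (rule measurableI) (auto simp: sets_restrict_space_iff)
  have sM: "sets M = sets borel" by (simp add: M_def)
  have em: "emeasure M B = ennreal (LINT t:B|unit_lebesgue. norm (f t))" if "B \<in> sets unit_borel" for B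
  proof -
    have B: "B \<in> sets unit_lebesgue" "B \<in> sets borel" "B \<subseteq> {0..1}"
      using that sets_unit_borel_lebesgue by (auto simp: sets_restrict_space_iff)
    have "emeasure M B = emeasure (density unit_lebesgue (\<lambda>t. ennreal (norm (f t)))) B"
      unfolding M_def using id B by (subst emeasure_distr) (auto simp: Int_absorb2)
    also have "\<dots> = (\<integral>\<^sup>+t. ennreal (indicator B t *\<^sub>R norm (f t)) \<partial>unit_lebesgue)"
      using B(1) by (subst emeasure_density) (auto intro!: nn_integral_cong simp: indicator_def)
    also have "\<dots> = ennreal (\<integral>t. indicator B t *\<^sub>R norm (f t) \<partial>unit_lebesgue)"
      using f B(1) by (intro nn_integral_eq_integral integrable_mult_indicator integrable_norm) auto
    finally show ?thesis by (simp add: set_lebesgue_integral_def)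
  qed
  have em_Int: "emeasure M B = emeasure M (B \<inter> {0..1})" if "B \<in> sets borel" for B
    unfolding M_def using that id
    by (subst (1 2) emeasure_distr) (auto intro!: arg_cong2[where f = emeasure])
  have "emeasure M UNIV = emeasure M {0..1}" using em_Int[of UNIV] by simp
  then have fin: "emeasure M (space M) \<noteq> \<infinity>"
    using em[of "{0..1}"] by (simp add: M_def sets_restrict_space_iff)
  then interpret finite_measure M by (rule finite_measureI)
  have Ab: "A \<in> sets borel" using A by (auto simp: sets_restrict_space_iff)
  have "emeasure M A < emeasure M A + ennreal (e / 2)" "emeasure M A \<noteq> \<infinity>"
    using e fin by (auto simp: emeasure_eq_measure ennreal_less_iff simp flip: ennreal_plus)
  then obtain G where G: "A \<subseteq> G" "open G" "emeasure M G < emeasure M A + ennreal (e / 2)"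
    using outer_regular[OF sM fin Ab] by (auto simp: INF_less_iff)
  have "\<exists>F. F \<subseteq> A \<and> compact F \<and> emeasure M A < emeasure M F + ennreal (e / 2)"
  proof (rule ccontr)
    assume "\<not> ?thesis"
    then have *: "emeasure M F + ennreal (e / 2) \<le> emeasure M A" if "F \<subseteq> A" "compact F" for F
      using that by (auto simp: not_less)
    have "measure M F \<le> measure M A - e / 2" if "F \<subseteq> A" "compact F" for F
      using *[OF that] e by (simp add: emeasure_eq_measure flip: ennreal_plus)
    then have "emeasure M A \<le> ennreal (measure M A - e / 2)"
      unfolding inner_regular[OF sM fin Ab]
      by (intro SUP_least) (auto simp: emeasure_eq_measure intro: ennreal_leI)
    moreover have "e / 2 \<le> measure M A"
      using *[of "{}"] e by (simp add: emeasure_eq_measure)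
    ultimately show False
      using e by (simp add: emeasure_eq_measure)
  qed
  then obtain F where F: "F \<subseteq> A" "compact F" "emeasure M A < emeasure M F + ennreal (e / 2)"
    by blast
  have FG: "measure M (G - F) < e"
  proof -
    have "measure M (G - F) = measure M G - measure M F"
      using G F by (intro finite_measure_Diff) (auto simp: sM borel_compact)
    moreover have "measure M G < measure M A + e / 2" "measure M A < measure M F + e / 2"
      using G(3) F(3) e by (simp_all add: emeasure_eq_measure ennreal_less_iff flip: ennreal_plus)
    ultimately show ?thesis by simp
  qed
  have "norm (L1_to_M (abs_L1 f) B) < e" if B: "B \<in> sets unit_borel" "B \<subseteq> G - F" for B
  proof -
    have "norm (L1_to_M (abs_L1 f) B) \<le> (LINT t:B|unit_lebesgue. norm (f t))"
      using norm_set_integral_le[OF B(1)] by (simp add: L1_to_M_abs[OF f] B)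
    also have "\<dots> = measure M B"
      unfolding measure_def em[OF B(1)]
      by (subst enn2real_ennreal) (auto simp: set_lebesgue_integral_def intro!: integral_nonneg_AE)
    also have "\<dots> \<le> measure M (G - F)"
      using B G F by (intro finite_measure_mono) (auto simp: sM borel_compact)
    finally show ?thesis using FG by simp
  qed
  then show "\<exists>F G. closed F \<and> open G \<and> F \<subseteq> A \<and> A \<subseteq> G \<and>
      (\<forall>B\<in>sets unit_borel. B \<subseteq> G - F \<longrightarrow> norm (L1_to_M (abs_L1 f) B) < e)"
    using F G by (intro exI[of _ F] exI[of _ G]) (auto intro: compact_imp_closed)
qed

lemma variation_L1_to_M:
  assumes "borel_partition \<P>"
  shows "(\<Sum>B\<in>\<P>. norm (L1_to_M (abs_L1 f) B)) \<le> L1_norm (abs_L1 f)"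
proof -
  have P: "finite \<P>" "disjoint \<P>" "\<And>B. B \<in> \<P> \<Longrightarrow> B \<in> sets unit_borel" "\<Union>\<P> = {0..1}"
    using assms by (auto simp: borel_partition_def)
  have "(\<Sum>B\<in>\<P>. norm (L1_to_M (abs_L1 f) B)) \<le> (\<Sum>B\<in>\<P>. LINT t:B|unit_lebesgue. norm (f t))"
    using P(3) norm_set_integral_le by (intro sum_mono) (auto simp: L1_to_M_abs[OF f])
  also have "\<dots> = (LINT t:(\<Union>B\<in>\<P>. B)|unit_lebesgue. norm (f t))"
    using P set_integrable_norm[OF set_integrable_unit] sets_unit_borel_lebesgue
    by (intro set_integral_finite_Union[symmetric]) (auto simp: disjoint_family_on_def disjoint_def)
  also have "\<dots> = L1_norm (abs_L1 f)"
    unfolding L1_norm_abs[OF f] set_lebesgue_integral_def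
    using P(4) by (intro Bochner_Integration.integral_cong) auto
  finally show ?thesis .
qed

end

lemma L1_to_M_pts: "L1_to_M u \<in> pts M_space"
proof -
  obtain f where f: "integrable unit_lebesgue f" "u = abs_L1 f" by (rule L1_cases)
  have "L1_to_M u A = 0" if "A \<notin> sets unit_borel" for A
    using that f by (simp add: L1_to_M.abs_eq)
  then show ?thesis
    using f total_variation_le(1)[OF variation_L1_to_M[OF f(1)]]
    by (simp add: M_space_def countably_additive_L1_to_M regular_L1_to_M)
qed

lemma linear_contraction_L1_to_M: "linear_contraction L1_space M_space L1_to_M"
  unfolding linear_contraction_def
proof (intro conjI ballI allI)
  fix u v :: "'a L1" and c :: 'a
  obtain f where f: "integrable unit_lebesgue f" "u = abs_L1 f" by (rule L1_cases)
  obtain g where g: "integrable unit_lebesgue g" "v = abs_L1 g" by (rule L1_cases)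
  show "nrm M_space (L1_to_M u) \<le> nrm L1_space u"
    using total_variation_le(2)[OF variation_L1_to_M[OF f(1)]] f
    by (simp add: M_space_def L1_space_def)
  show "L1_to_M (u + v) = L1_to_M u + L1_to_M v"
  proof
    fix A show "L1_to_M (u + v) A = (L1_to_M u + L1_to_M v) A"
      using set_integral_add(2)[OF set_integrable_unit[OF f(1)] set_integrable_unit[OF g(1)]] f g
      by (cases "A \<in> sets unit_borel") (auto simp: abs_L1_add L1_to_M.abs_eq)
  qed
  show "L1_to_M (smult L1_space c u) = smult M_space c (L1_to_M u)"
  proof
    fix A show "L1_to_M (smult L1_space c u) A = smult M_space c (L1_to_M u) A"
      using f by (cases "A \<in> sets unit_borel")
        (auto simp: abs_L1_scale L1_to_M.abs_eq L1_space_def M_space_def pw_scale_def)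
  qed
qed (auto simp: L1_to_M_pts)

section \<open>Averaging over cells\<close>

text \<open>
  This is the left inverse of the step-function embedding. It is defined on measures; composed with
  the embedding of integrable functions it takes the integrals over the cells.
\<close>

definition cell_mass :: "nat \<Rightarrow> (real set \<Rightarrow> 'k::scalar_field) \<Rightarrow> nat \<Rightarrow> 'k" where
  "cell_mass N \<mu> = (\<lambda>j. if j < N then \<mu> (cell N j) else 0)"

lemma borel_partition_cells: "0 < N \<Longrightarrow> borel_partition (cell N ` {..<N})"
  using disjoint_family_on_disjoint_image[OF disjoint_family_cells, of N]
  by (auto simp: borel_partition_def UN_cells cell_sets)

lemma cell_nonempty: "j < N \<Longrightarrow> cell N j \<noteq> {}"
  by (auto simp: cell_def divide_strict_right_mono)

lemma inj_on_cell: "inj_on (cell N) {..<N}"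
  using cell_nonempty cell_unique by (intro inj_onI) (metis ex_in_conv lessThan_iff)

lemma linear_contraction_cell_mass:
  assumes "0 < N"
  shows "linear_contraction M_space (ell1 N) (cell_mass N)"
proof -
  have "(\<Sum>j<N. norm (\<mu> (cell N j))) \<le> total_variation \<mu>"
    if "bdd_above (variation_sums \<mu>)" for \<mu> :: "real set \<Rightarrow> 'k::scalar_field"
    using variation_le[OF that borel_partition_cells[OF assms]]
    by (simp add: sum.reindex[OF inj_on_cell])
  then show ?thesis
    by (auto simp: linear_contraction_def M_space_def ell1_def cell_mass_def pw_scale_def)
qed

lemma integral_indicator_unit:
  assumes "A \<in> sets unit_lebesgue"
  shows "(\<integral>t. indicator A t \<partial>unit_lebesgue) = (of_real (measure unit_lebesgue A) :: 'k::scalar_field)"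
proof -
  have "(\<integral>t. indicator A t \<partial>unit_lebesgue) = (\<integral>t. indicat_real A t *\<^sub>R (1 :: 'k) \<partial>unit_lebesgue)"
    by (intro Bochner_Integration.integral_cong) (auto simp: indicator_def)
  also have "\<dots> = of_real (measure unit_lebesgue A)"
    using assms finite_measure.emeasure_finite[OF finite_measure_unit_lebesgue, of A]
      sets.sets_into_space[OF assms]
    by (subst integral_scaleR_left) (auto simp: Int_absorb2 of_real_def less_top[symmetric])
  finally show ?thesis .
qed

lemma cell_mass_J:
  fixes x :: "nat \<Rightarrow> 'k::scalar_field"
  assumes "j < N" "1 \<le> m"
  shows "cell_mass N (L1_to_M (J (N * m) x)) j = (\<Sum>i | i < N * m \<and> i div m = j. x i)"
proof -
  let ?M = "N * m"
  have *: "indicator (cell N j) t *\<^sub>R (x i * (of_nat ?M * indicator (cell ?M i) t))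
      = (if i div m = j then x i else 0) * (of_nat ?M * indicator (cell ?M i) t)" if "i < ?M" for i t
  proof -
    have "i div m < N" using that by (simp add: less_mult_imp_div_less)
    then have "t \<in> cell ?M i \<Longrightarrow> t \<in> cell N j \<longleftrightarrow> i div m = j"
      using cell_refine[OF that] cell_unique assms by blast
    then show ?thesis by (auto simp: indicator_def)
  qed
  have "cell_mass N (L1_to_M (J ?M x)) j = (\<integral>t. indicator (cell N j) t *\<^sub>R
      (\<Sum>i<?M. x i * (of_nat ?M * indicator (cell ?M i) t)) \<partial>unit_lebesgue)"
    using assms by (simp add: cell_mass_def J_abs L1_to_M_abs[OF integrable_step] cell_sets
        set_lebesgue_integral_def del: of_nat_mult)
  also have "\<dots> = (\<integral>t. (\<Sum>i<?M. (if i div m = j then x i else 0) *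
      (of_nat ?M * indicator (cell ?M i) t)) \<partial>unit_lebesgue)"
    unfolding scaleR_sum_right
    by (intro Bochner_Integration.integral_cong refl sum.cong *) simp
  also have "\<dots> = (\<Sum>i<?M. (if i div m = j then x i else 0) *
      (of_nat ?M * of_real (measure unit_lebesgue (cell ?M i))))"
    by (subst Bochner_Integration.integral_sum)
       (auto intro!: integrable_mult_right integrable_indicator_unit sum.cong integral_indicator_unit
         sets_unit_borel_lebesgue cell_sets)
  also have "\<dots> = (\<Sum>i<?M. if i div m = j then x i else 0)"
    by (intro sum.cong) (auto simp: measure_cell)
  also have "\<dots> = (\<Sum>i | i < ?M \<and> i div m = j. x i)"
    by (subst sum.inter_filter[symmetric]) auto
  finally show ?thesis .
qed

lemma cell_mass_J_same:
  assumes "x \<in> pts (ell1 N)"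
  shows "cell_mass N (L1_to_M (J N x)) = x"
proof
  fix j
  have "{i. i < N \<and> i = j} = {j}" if "j < N" using that by auto
  then show "cell_mass N (L1_to_M (J N x)) j = x j"
    using cell_mass_J[of j N 1 x] assms
    by (cases "j < N") (auto simp: ell1_def cell_mass_def)
qed

lemma contractive_retract_M:
  assumes "0 < N"
  shows "contractive_retract (ell1 N) M_space (L1_to_M \<circ> J N) (cell_mass N)"
  using linear_contraction_compose[OF linear_contraction_J linear_contraction_L1_to_M]
  by unfold_locales
    (auto simp: normed_carrier_ell1 normed_carrier_M linear_contraction_cell_mass assms cell_mass_J_same)

lemma contractive_retract_L1:
  assumes "0 < N"
  shows "contractive_retract (ell1 N) L1_space (J N) (cell_mass N \<circ> L1_to_M)"
  using linear_contraction_compose[OF linear_contraction_L1_to_M linear_contraction_cell_mass[OF assms]]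
  by unfold_locales
    (auto simp: normed_carrier_ell1 normed_carrier_L1 linear_contraction_J cell_mass_J_same)

section \<open>Density of step functions\<close>

lemma L1_norm_dominated_convergence:
  fixes f :: "real \<Rightarrow> 'k::scalar_field"
  assumes f: "integrable unit_lebesgue f" and s: "\<And>i. integrable unit_lebesgue (s i)"
    and w: "integrable unit_lebesgue w"
    and lim: "\<And>t. t \<in> {0..1} \<Longrightarrow> (\<lambda>i. s i t) \<longlonglongrightarrow> f t"
    and bound: "\<And>i t. t \<in> {0..1} \<Longrightarrow> norm (s i t) \<le> w t"
  shows "(\<lambda>i. L1_norm (abs_L1 f - abs_L1 (s i))) \<longlonglongrightarrow> 0"
proof -
  have "(\<lambda>i. \<integral>t. norm (f t - s i t) \<partial>unit_lebesgue) \<longlonglongrightarrow> (\<integral>t. 0 \<partial>unit_lebesgue)"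
  proof (rule integral_dominated_convergence[where w = "\<lambda>t. norm (f t) + w t"])
    show "(\<lambda>t. norm (f t - s i t)) \<in> borel_measurable unit_lebesgue" for i
      using f s by (intro borel_measurable_integrable integrable_norm Bochner_Integration.integrable_diff)
    show "integrable unit_lebesgue (\<lambda>t. norm (f t) + w t)" using f w by simp
    show "AE t in unit_lebesgue. (\<lambda>i. norm (f t - s i t)) \<longlonglongrightarrow> 0"
    proof (rule AE_I2)
      fix t assume "t \<in> space unit_lebesgue"
      then have "(\<lambda>i. f t - s i t) \<longlonglongrightarrow> f t - f t"
        using lim by (intro tendsto_diff tendsto_const) simp
      then show "(\<lambda>i. norm (f t - s i t)) \<longlonglongrightarrow> 0"
        by (simp add: tendsto_norm_zero)
    qed
    show "AE t in unit_lebesgue. norm (norm (f t - s i t)) \<le> norm (f t) + w t" for i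
    proof (rule AE_I2)
      fix t assume "t \<in> space unit_lebesgue"
      then have "norm (s i t) \<le> w t" using bound by simp
      then show "norm (norm (f t - s i t)) \<le> norm (f t) + w t"
        using norm_triangle_ineq4[of "f t" "s i t"] by simp
    qed
  qed simp
  then show ?thesis
    using f s by (simp add: abs_L1_diff L1_norm_abs)
qed

text \<open>
  The densities of all cells of the partitions into \<open>N * m\<close> cells span a dense subspace of the Lebesgue
  space, although \<open>N\<close> is fixed: their endpoints are dense in the interval. In the form used here, a
  closed subspace that contains them is everything. The indicators belonging to the subspace are
  enlarged step by step: initial segments, Borel sets (Dynkin's lemma), Lebesgue sets, and from these
  one reaches all integrable functions.
\<close>

locale closed_subspace_with_cells =
  fixes Z :: "'k::scalar_field L1 set" and N :: nat
  assumes N: "0 < N"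
    and Z_add: "u \<in> Z \<Longrightarrow> v \<in> Z \<Longrightarrow> u + v \<in> Z"
    and Z_scale: "u \<in> Z \<Longrightarrow> L1_scale c u \<in> Z"
    and Z_lim: "(\<And>i::nat. s i \<in> Z) \<Longrightarrow> (\<lambda>i. L1_norm (u - s i)) \<longlonglongrightarrow> 0 \<Longrightarrow> u \<in> Z"
    and Z_cell: "1 \<le> m \<Longrightarrow> i < N * m \<Longrightarrow> cell_density (N * m) i \<in> Z"
begin

abbreviation ind :: "real set \<Rightarrow> 'k L1" where
  "ind A \<equiv> abs_L1 (indicator (A \<inter> {0..1}))"

lemma integrable_ind:
  "A \<in> sets borel \<Longrightarrow> integrable unit_lebesgue (indicator (A \<inter> {0..1}) :: real \<Rightarrow> 'k)"
  by (intro integrable_indicator_unit) (auto simp: sets_restrict_space_iff)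

lemma Z_zero: "0 \<in> Z"
  using Z_scale[of "cell_density (N * 1) 0" 0] Z_cell[of 1 0] N by (simp add: L1_scale_zero_left)

lemma Z_diff: "u \<in> Z \<Longrightarrow> v \<in> Z \<Longrightarrow> u - v \<in> Z"
proof -
  assume u: "u \<in> Z" and v: "v \<in> Z"
  have eq: "u - v = u + L1_scale (- 1) v" by transfer simp
  show ?thesis unfolding eq using u v by (intro Z_add Z_scale)
qed

lemma Z_sum: "(\<And>i. i \<in> I \<Longrightarrow> u i \<in> Z) \<Longrightarrow> (\<Sum>i\<in>I. u i) \<in> Z"
  by (induction I rule: infinite_finite_induct) (auto simp: Z_zero Z_add)

lemma Z_J: "1 \<le> m \<Longrightarrow> J (N * m) x \<in> Z"
  unfolding J_def by (intro Z_sum Z_scale Z_cell) auto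

text \<open>
  Cutting off at the cells that start before \<open>a\<close> gives a step function that differs from the indicator
  only within one cell length to the right of \<open>a\<close>.
\<close>

lemma Z_initial_segment: "ind {..<a} \<in> Z"
proof -
  define x where "x n i = (if real i / real (N * Suc n) < a then 1 / of_nat (N * Suc n) else 0 :: 'k)"
    for n i
  have le: "L1_norm (ind {..<a} - J (N * Suc n) (x n)) \<le> 1 / real (Suc n)" for n
  proof -
    define M where "M = N * Suc n"
    have M: "0 < M" using N by (simp add: M_def)
    let ?D = "{a..a + 1 / real M} \<inter> {0..1}"
    let ?f = "\<lambda>t. indicator ({..<a} \<inter> {0..1}) t
        - (\<Sum>i<M. x n i * (of_nat M * indicator (cell M i) t)) :: 'k"
    have D: "?D \<in> sets unit_lebesgue" by (auto simp: sets_restrict_space_iff)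
    have "norm (?f t) \<le> indicator ?D t" if t01: "t \<in> {0..1}" for t
    proof -
      obtain i where i: "i < M" "t \<in> cell M i" using t01 M by (rule cell_cover)
      have "(\<Sum>i<M. x n i * (of_nat M * indicator (cell M i) t)) = x n i * of_nat M"
        using sum_indicator_cells[OF i(2,1), of "\<lambda>i. x n i * of_nat M"] by (simp add: mult.assoc)
      also have "\<dots> = (if real i / real M < a then 1 else 0)"
        using M unfolding x_def M_def[symmetric] by simp
      finally have f: "?f t = (if t < a then 1 else 0) - (if real i / real M < a then 1 else 0)"
        using t01 by (simp add: indicator_def)
      have "real i / real M \<le> t" "t \<le> real i / real M + 1 / real M"
        using cell_bounds(1)[OF i(2)] cell_width[OF i(2)] .
      then show ?thesis using t01 unfolding f by (auto simp: indicator_def)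
    qed
    note le = this
    have int: "integrable unit_lebesgue ?f"
      by (intro Bochner_Integration.integrable_diff integrable_ind integrable_step) simp
    have "L1_norm (ind {..<a} - J M (x n)) = (\<integral>t. norm (?f t) \<partial>unit_lebesgue)"
      unfolding J_abs abs_L1_diff[OF integrable_ind[OF lessThan_borel] integrable_step]
      by (rule L1_norm_abs[OF int])
    also have "\<dots> \<le> (\<integral>t. indicator ?D t \<partial>unit_lebesgue)"
      by (rule integral_mono[OF integrable_norm[OF int] integrable_indicator_unit[OF D] le]) simp
    also have "\<dots> = measure lebesgue ?D"
      using D by (simp add: measure_restrict_space Int_absorb2)
    also have "\<dots> \<le> measure lebesgue {a..a + 1 / real M}"
      by (intro measure_mono_fmeasurable) auto
    also have "\<dots> = 1 / real M" by simp
    also have "\<dots> \<le> 1 / real (Suc n)"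
    proof (rule divide_left_mono)
      have "1 * Suc n \<le> M" unfolding M_def using N by (intro mult_le_mono1) simp
      then show "real (Suc n) \<le> real M" by simp
    qed (use M in auto)
    finally show ?thesis by (simp add: M_def)
  qed
  have "(\<lambda>n. L1_norm (ind {..<a} - J (N * Suc n) (x n))) \<longlonglongrightarrow> 0"
  proof (rule Lim_null_comparison[OF always_eventually LIMSEQ_Suc[OF lim_1_over_n]], rule allI)
    show "norm (L1_norm (ind {..<a} - J (N * Suc n) (x n))) \<le> 1 / real (Suc n)" for n
      using le[of n] by (simp only: real_norm_def abs_of_nonneg[OF L1_norm_nonneg])
  qed
  then show ?thesis by (rule Z_lim[rotated]) (rule Z_J, simp)
qed

lemma Z_borel:
  assumes "A \<in> sets borel"
  shows "ind A \<in> Z"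
proof -
  have A: "A \<in> sigma_sets UNIV (range lessThan)"
    using assms by (subst (asm) borel_Iio) simp
  have "{..<a} \<inter> {..<b} = {..<min a b}" for a b :: real by auto
  then have stable: "Int_stable (range lessThan :: real set set)"
    by (auto simp: Int_stable_def)
  show ?thesis
    using stable subset_UNIV[of "range lessThan", unfolded Pow_UNIV[symmetric]] A
  proof (induction rule: sigma_sets_induct_disjoint)
    case (basic A)
    then show ?case using Z_initial_segment by auto
  next
    case empty
    have "ind {} = abs_L1 (\<lambda>_. 0)" by (rule arg_cong[where f = abs_L1]) auto
    then show ?case by (simp add: abs_L1_zero Z_zero)
  next
    case (compl A)
    then have A: "A \<in> sets borel" by (subst borel_Iio) simp
    have "ind {..<2} \<in> Z" by (rule Z_initial_segment)
    then have "ind {..<2} - ind A \<in> Z" using compl by (intro Z_diff)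
    also have "ind {..<2} - ind A = abs_L1 (\<lambda>t. indicator ({..<2} \<inter> {0..1}) t - indicator (A \<inter> {0..1}) t)"
      by (intro abs_L1_diff integrable_ind A) auto
    also have "\<dots> = ind (UNIV - A)"
      by (rule arg_cong[where f = abs_L1]) (auto simp: indicator_def)
    finally show ?case .
  next
    case (union A)
    then have A: "A i \<in> sets borel" for i by (subst borel_Iio) auto
    have partial: "ind (\<Union>i<n. A i) \<in> Z" for n
    proof (induction n)
      case 0
      have "ind {} = abs_L1 (\<lambda>_. 0)" by (rule arg_cong[where f = abs_L1]) auto
      then show ?case by (simp add: abs_L1_zero Z_zero)
    next
      case (Suc n)
      have "A n \<inter> A i = {}" if "i < n" for i
        using union(1) that by (intro disjoint_family_onD) auto
      then have "A n \<inter> (\<Union>i<n. A i) = {}" by blast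
      then have "ind (\<Union>i<Suc n. A i)
          = abs_L1 (\<lambda>t. indicator ((\<Union>i<n. A i) \<inter> {0..1}) t + indicator (A n \<inter> {0..1}) t)"
        by (intro arg_cong[where f = abs_L1]) (auto simp: indicator_def lessThan_Suc fun_eq_iff)
      also have "\<dots> = ind (\<Union>i<n. A i) + ind (A n)"
        using A by (intro abs_L1_add[symmetric] integrable_ind) auto
      finally show ?case using Suc union(3) by (simp add: Z_add)
    qed
    show ?case
    proof (rule Z_lim[OF partial], rule L1_norm_dominated_convergence[where w = "\<lambda>_. 1"])
      show "(\<lambda>n. indicator ((\<Union>i<n. A i) \<inter> {0..1}) t :: 'k)
          \<longlonglongrightarrow> indicator ((\<Union>i. A i) \<inter> {0..1}) t" if "t \<in> {0..1}" for t
      proof -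
        have "(\<lambda>n. indicator (\<Union>i<n. A i) t :: 'k) \<longlonglongrightarrow> indicator (\<Union>i. A i) t"
          by (rule LIMSEQ_indicator_UN)
        then show ?thesis using that by (simp add: indicator_inter_arith)
      qed
      show "integrable unit_lebesgue (\<lambda>_. 1 :: real)"
        using finite_measure_unit_lebesgue by (simp add: finite_measure.integrable_const)
      show "norm (indicator ((\<Union>i<n. A i) \<inter> {0..1}) t :: 'k) \<le> 1" for n t
        by (simp add: indicator_def)
    qed (use A in \<open>auto intro!: integrable_ind\<close>)
  qed
qed

lemma Z_lebesgue:
  assumes "A \<in> sets unit_lebesgue"
  shows "abs_L1 (indicator A) \<in> Z"
proof -
  have A: "A \<in> sets (completion lborel)" "A \<subseteq> {0..1}"
    using assms by (auto simp: sets_restrict_space_iff)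
  obtain S E E' where S: "A = S \<union> E" "E \<subseteq> E'" "E' \<in> null_sets lborel" "S \<in> sets lborel"
    using A(1) by (rule sets_completionE)
  have "AE t in lebesgue. t \<notin> E'"
    using S(3) by (intro AE_not_in) (simp add: null_sets_completionI)
  then have "AE t in unit_lebesgue. t \<notin> E'"
    by (subst AE_restrict_space_iff) auto
  then have "AE t in unit_lebesgue. (indicator A t :: 'k) = indicator (S \<inter> {0..1}) t"
    by eventually_elim (use S A in \<open>auto simp: indicator_def\<close>)
  then have "abs_L1 (indicator A) = ind S"
    using S by (intro abs_L1_cong integrable_indicator_unit assms integrable_ind) auto
  then show ?thesis using Z_borel S by simp
qed

lemma Z_UNIV: "u \<in> Z"
proof -
  obtain f where "integrable unit_lebesgue f" "u = abs_L1 f" by (rule L1_cases)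
  moreover have "abs_L1 f \<in> Z" if "integrable unit_lebesgue f" for f
    using that
  proof (induction rule: integrable_induct)
    case (base A c)
    have "abs_L1 (\<lambda>t. indicat_real A t *\<^sub>R c) = L1_scale c (abs_L1 (indicator A))"
      using integrable_indicator_unit[OF base(1), where 'k = 'k]
      by (simp add: abs_L1_scale) (rule arg_cong[where f = abs_L1], auto simp: indicator_def)
    then show ?case using Z_scale[OF Z_lebesgue[OF base(1)]] by simp
  next
    case (add f g)
    then show ?case by (simp add: Z_add flip: abs_L1_add)
  next
    case (lim f s)
    show ?case
    proof (rule Z_lim[of "\<lambda>i. abs_L1 (s i)"])
      show "(\<lambda>i. L1_norm (abs_L1 f - abs_L1 (s i))) \<longlonglongrightarrow> 0"
        using lim by (intro L1_norm_dominated_convergence[where w = "\<lambda>t. 2 * norm (f t)"]) auto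
    qed (rule lim)
  qed
  ultimately show ?thesis by simp
qed

end

section \<open>Integration against continuous functions and weak* limits\<close>

lemma continuous_times_integrable:
  fixes f g :: "real \<Rightarrow> 'k::scalar_field"
  assumes f: "integrable unit_lebesgue f" and g: "continuous_on {0..1} g"
  shows "integrable unit_lebesgue (\<lambda>t. g t * f t)"
proof -
  have "bounded (g ` {0..1})"
    using g by (intro compact_imp_bounded compact_continuous_image) auto
  then obtain B where B: "\<And>t. t \<in> {0..1} \<Longrightarrow> norm (g t) \<le> B"
    unfolding bounded_iff by blast
  have meas: "g \<in> borel_measurable unit_lebesgue"
    using g by (intro continuous_imp_measurable_on_sets_lebesgue) auto
  show ?thesis
  proof (rule Bochner_Integration.integrable_bound)
    show "integrable unit_lebesgue (\<lambda>t. B * norm (f t))" using f by simp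
    show "(\<lambda>t. g t * f t) \<in> borel_measurable unit_lebesgue"
      using meas f by (intro borel_measurable_times) auto
    show "AE t in unit_lebesgue. norm (g t * f t) \<le> norm (B * norm (f t))"
    proof (rule AE_I2)
      fix t assume "t \<in> space unit_lebesgue"
      then have "norm (g t) \<le> \<bar>B\<bar>" using B[of t] by simp
      then show "norm (g t * f t) \<le> norm (B * norm (f t))"
        by (simp add: norm_mult abs_mult mult_right_mono)
    qed
  qed
qed

lemma simple_integral_L1_to_M:
  fixes f s :: "real \<Rightarrow> 'k::scalar_field"
  assumes f: "integrable unit_lebesgue f" and s: "simple_function unit_borel s"
  shows "integrable unit_lebesgue (\<lambda>t. s t * f t)"
    and "simple_integral (L1_to_M (abs_L1 f)) s = (\<integral>t. s t * f t \<partial>unit_lebesgue)"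
proof -
  let ?A = "\<lambda>y. s -` {y} \<inter> {0..1}"
  let ?h = "\<lambda>t. \<Sum>y\<in>s ` {0..1}. y * (indicator (?A y) t *\<^sub>R f t)"
  have A: "?A y \<in> sets unit_borel" if "y \<in> s ` {0..1}" for y
    using s that by (auto simp: simple_function_def)
  have fin: "finite (s ` {0..1})" using s by (auto simp: simple_function_def)
  have int: "integrable unit_lebesgue (\<lambda>t. indicator (?A y) t *\<^sub>R f t)" if "y \<in> s ` {0..1}" for y
    using set_integrable_unit[OF f A[OF that]] by (simp add: set_integrable_def)
  have eq: "s t * f t = ?h t" if "t \<in> space unit_lebesgue" for t
  proof -
    have "?h t = (\<Sum>y\<in>s ` {0..1}. if y = s t then s t * f t else 0)"
      using that by (intro sum.cong) (auto simp: indicator_def)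
    then show ?thesis using fin that by simp
  qed
  have inth: "integrable unit_lebesgue ?h"
    using int by (intro Bochner_Integration.integrable_sum integrable_mult_right) auto
  then show "integrable unit_lebesgue (\<lambda>t. s t * f t)"
    using eq by (subst Bochner_Integration.integrable_cong[OF refl, where g = ?h]) auto
  have "(\<integral>t. s t * f t \<partial>unit_lebesgue) = (\<integral>t. ?h t \<partial>unit_lebesgue)"
    by (intro Bochner_Integration.integral_cong eq refl)
  also have "\<dots> = (\<Sum>y\<in>s ` {0..1}. y * (\<integral>t. indicator (?A y) t *\<^sub>R f t \<partial>unit_lebesgue))"
    using int by (subst Bochner_Integration.integral_sum)
      (auto simp del: mult_scaleR_right intro!: integrable_mult_right sum.cong)
  also have "\<dots> = simple_integral (L1_to_M (abs_L1 f)) s"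
    unfolding simple_integral_def
    by (intro sum.cong refl) (simp add: L1_to_M_abs[OF f A] set_lebesgue_integral_def)
  finally show "simple_integral (L1_to_M (abs_L1 f)) s = (\<integral>t. s t * f t \<partial>unit_lebesgue)" ..
qed

lemma simple_integral_tendsto:
  fixes f g :: "real \<Rightarrow> 'k::scalar_field"
  assumes f: "integrable unit_lebesgue f" and g: "continuous_on {0..1} g"
    and s: "\<And>n. simple_function unit_borel (s n)" and lim: "uniform_limit {0..1} s g sequentially"
  shows "(\<lambda>n. simple_integral (L1_to_M (abs_L1 f)) (s n)) \<longlonglongrightarrow> (\<integral>t. g t * f t \<partial>unit_lebesgue)"
proof (rule metric_LIMSEQ_I)
  fix e :: real assume e: "0 < e"
  let ?c = "L1_norm (abs_L1 f) + 1"
  have c: "0 < ?c" using L1_norm_nonneg[of "abs_L1 f"] by simp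
  then have "0 < e / ?c" using e by simp
  then obtain n0 where n0: "\<And>n t. n0 \<le> n \<Longrightarrow> t \<in> {0..1} \<Longrightarrow> dist (s n t) (g t) < e / ?c"
    using lim unfolding uniform_limit_sequentially_iff by meson
  have "dist (simple_integral (L1_to_M (abs_L1 f)) (s n)) (\<integral>t. g t * f t \<partial>unit_lebesgue) < e"
    if "n0 \<le> n" for n
  proof -
    note int = simple_integral_L1_to_M(1)[OF f s, of n] continuous_times_integrable[OF f g]
    have "simple_integral (L1_to_M (abs_L1 f)) (s n) - (\<integral>t. g t * f t \<partial>unit_lebesgue)
        = (\<integral>t. s n t * f t - g t * f t \<partial>unit_lebesgue)"
      using int by (simp add: simple_integral_L1_to_M(2)[OF f s])
    also have "norm \<dots> \<le> (\<integral>t. norm (s n t * f t - g t * f t) \<partial>unit_lebesgue)"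
      by (rule integral_norm_bound)
    also have "\<dots> \<le> (\<integral>t. e / ?c * norm (f t) \<partial>unit_lebesgue)"
    proof (rule integral_mono)
      fix t assume "t \<in> space unit_lebesgue"
      then have "norm (s n t - g t) \<le> e / ?c"
        using n0[OF that, of t] by (simp add: dist_norm)
      moreover have "norm (s n t * f t - g t * f t) = norm (s n t - g t) * norm (f t)"
        by (metis left_diff_distrib norm_mult)
      ultimately show "norm (s n t * f t - g t * f t) \<le> e / ?c * norm (f t)"
        by (simp only: mult_right_mono norm_ge_zero)
    qed (use int f in auto)
    also have "\<dots> = e / ?c * L1_norm (abs_L1 f)" by (simp add: L1_norm_abs[OF f])
    also have "\<dots> < e"
      using e c by (simp add: field_simps)
    finally show ?thesis by (simp add: dist_norm)
  qed
  then show "\<exists>n0. \<forall>n\<ge>n0. dist (simple_integral (L1_to_M (abs_L1 f)) (s n))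
      (\<integral>t. g t * f t \<partial>unit_lebesgue) < e" by blast
qed

text \<open>
  Evaluating \<open>g\<close> at the largest multiple of \<open>1 / Suc n\<close> below the argument uses finitely many values of
  \<open>g\<close>, and uniform continuity controls the error.
\<close>

lemma uniform_limit_simple_functions:
  fixes g :: "real \<Rightarrow> 'k::scalar_field"
  assumes g: "continuous_on {0..1} g"
  obtains s where "\<And>n. simple_function unit_borel (s n)" "uniform_limit {0..1} s g sequentially"
proof
  let ?r = "\<lambda>n t. real_of_int \<lfloor>t * real (Suc n)\<rfloor> / real (Suc n)"
  let ?s = "\<lambda>n t. g (?r n t)"
  show "simple_function unit_borel (?s n)" for n
  proof (rule simple_function_compose1[of _ "?r n"], rule simple_function_borel_measurable)
    show "?r n \<in> borel_measurable unit_borel"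
      by (rule measurable_restrict_space1) measurable
    have "\<lfloor>t * real (Suc n)\<rfloor> \<in> {0..int (Suc n)}" if "t \<in> {0..1}" for t
    proof -
      have "t * real (Suc n) \<le> real (Suc n)"
        using that by (intro mult_left_le_one_le) auto
      from floor_mono[OF this] show ?thesis using that by simp
    qed
    then have "?r n ` space unit_borel \<subseteq> (\<lambda>k. real_of_int k / real (Suc n)) ` {0..int (Suc n)}"
      by auto
    then show "finite (?r n ` space unit_borel)" by (rule finite_subset) simp
  qed
  have "uniformly_continuous_on {0..1} g"
    using g by (intro compact_uniformly_continuous) auto
  show "uniform_limit {0..1} ?s g sequentially"
    unfolding uniform_limit_sequentially_iff
  proof (intro allI impI)
    fix e :: real assume "0 < e"
    then obtain d where d: "0 < d"
      "\<And>t t'. t \<in> {0..1} \<Longrightarrow> t' \<in> {0..1} \<Longrightarrow> dist t' t < d \<Longrightarrow> dist (g t') (g t) < e"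
      using \<open>uniformly_continuous_on {0..1} g\<close> unfolding uniformly_continuous_on_def by meson
    obtain n0 where n0: "1 / real (Suc n0) < d"
      using d(1) nat_approx_posE by metis
    have "dist (?s n t) (g t) < e" if n: "n0 \<le> n" and t: "t \<in> {0..1}" for n t
    proof (rule d(2)[OF t])
      have lo: "real_of_int \<lfloor>t * real (Suc n)\<rfloor> \<le> t * real (Suc n)"
        and up: "t * real (Suc n) < real_of_int \<lfloor>t * real (Suc n)\<rfloor> + 1" by linarith+
      have pos: "0 \<le> real_of_int \<lfloor>t * real (Suc n)\<rfloor>" using t by simp
      have 1: "?r n t \<le> t" using lo by (simp add: pos_divide_le_eq)
      have 2: "t < ?r n t + 1 / real (Suc n)"
        using up by (simp add: pos_less_divide_eq flip: add_divide_distrib)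
      have "1 / real (Suc n) \<le> 1 / real (Suc n0)" using n by (intro divide_left_mono) auto
      then show "dist (?r n t) t < d" using 1 2 n0 by (simp add: dist_real_def)
      have "0 \<le> ?r n t" using pos by (intro divide_nonneg_nonneg) auto
      then show "?r n t \<in> {0..1}" using 1 t unfolding atLeastAtMost_iff by linarith
    qed
    then show "\<exists>n0. \<forall>n\<ge>n0. \<forall>t\<in>{0..1}. dist (?s n t) (g t) < e" by blast
  qed
qed

text \<open>
  All uniformly convergent sequences of simple functions give the limit claimed here; that such a
  sequence exists makes it the only candidate in the definite description.
\<close>

lemma measure_integral_L1_to_M:
  fixes f g :: "real \<Rightarrow> 'k::scalar_field"
  assumes f: "integrable unit_lebesgue f" and g: "continuous_on {0..1} g"
  shows "measure_integral (L1_to_M (abs_L1 f)) g = (\<integral>t. g t * f t \<partial>unit_lebesgue)"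
  unfolding measure_integral_def
proof (rule the_equality)
  fix I
  assume I: "\<forall>s. (\<forall>n. simple_function unit_borel (s n)) \<and> uniform_limit {0..1} s g sequentially
        \<longrightarrow> (\<lambda>n. simple_integral (L1_to_M (abs_L1 f)) (s n)) \<longlonglongrightarrow> I"
  obtain s where s: "\<And>n. simple_function unit_borel (s n)" "uniform_limit {0..1} s g sequentially"
    using uniform_limit_simple_functions[OF g] by blast
  show "I = (\<integral>t. g t * f t \<partial>unit_lebesgue)"
    using I s simple_integral_tendsto[OF f g s] LIMSEQ_unique by blast
qed (use simple_integral_tendsto[OF f g] in blast)

lemma measure_integral_diff:
  fixes u v :: "'k::scalar_field L1"
  assumes g: "continuous_on {0..1} g"
  shows "measure_integral (L1_to_M (u - v)) g
    = measure_integral (L1_to_M u) g - measure_integral (L1_to_M v) g"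
proof -
  obtain f where f: "integrable unit_lebesgue f" "u = abs_L1 f" by (rule L1_cases)
  obtain h where h: "integrable unit_lebesgue h" "v = abs_L1 h" by (rule L1_cases)
  show ?thesis
    using f h continuous_times_integrable[OF _ g]
    by (simp add: abs_L1_diff measure_integral_L1_to_M[OF _ g] right_diff_distrib)
qed

lemma measure_integral_zero:
  "continuous_on {0..1} g \<Longrightarrow> measure_integral (L1_to_M (0 :: 'k::scalar_field L1)) g = 0"
  using measure_integral_diff[of g "0 :: 'k L1" 0] by simp

text \<open>
  Averages of a continuous function over cells that shrink to a point tend to its value there. Thus
  two sequences of cells on different sides of \<open>t0\<close> have the same weak* limit, although in norm their
  densities stay at distance 2.
\<close>

lemma cell_density_tendsto_point_mass:
  fixes g :: "real \<Rightarrow> 'k::scalar_field"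
  assumes g: "continuous_on {0..1} g" and t0: "t0 \<in> {0..1}"
    and i: "\<And>n. i n < M n" and M: "(\<lambda>n. 1 / real (M n)) \<longlonglongrightarrow> 0"
    and near: "\<And>n t. t \<in> cell (M n) (i n) \<Longrightarrow> \<bar>t - t0\<bar> \<le> 1 / real (M n)"
  shows "(\<lambda>n. measure_integral (L1_to_M (cell_density (M n) (i n))) g) \<longlonglongrightarrow> g t0"
proof (rule metric_LIMSEQ_I)
  fix e :: real assume e: "0 < e"
  then obtain d where d: "0 < d" "\<And>t. t \<in> {0..1} \<Longrightarrow> dist t t0 < d \<Longrightarrow> dist (g t) (g t0) < e / 2"
    using g t0 unfolding continuous_on_iff by (meson half_gt_zero)
  obtain n0 where n0: "\<And>n. n0 \<le> n \<Longrightarrow> 1 / real (M n) < d"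
    using metric_LIMSEQ_D[OF M d(1)] by auto
  have "dist (measure_integral (L1_to_M (cell_density (M n) (i n))) g) (g t0) < e" if n: "n0 \<le> n" for n
  proof -
    let ?C = "cell (M n) (i n)"
    let ?f = "\<lambda>t. of_nat (M n) * indicator ?C t :: 'k"
    have M: "0 < M n" using i[of n] by simp
    note f = integrable_cell[OF i, where 'k = 'k]
    have C: "?C \<in> sets unit_lebesgue" using i by (intro sets_unit_borel_lebesgue cell_sets)
    have one: "(\<integral>t. ?f t \<partial>unit_lebesgue) = 1"
      using M by (simp add: integral_indicator_unit[OF C] measure_cell i)
    have int: "integrable unit_lebesgue (\<lambda>t. (g t - g t0) * ?f t)"
      using g by (intro continuous_times_integrable f continuous_intros)
    have "measure_integral (L1_to_M (cell_density (M n) (i n))) g - g t0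
        = (\<integral>t. g t * ?f t \<partial>unit_lebesgue) - (\<integral>t. g t0 * ?f t \<partial>unit_lebesgue)"
      using one by (simp add: cell_density_abs measure_integral_L1_to_M[OF f g])
    also have "\<dots> = (\<integral>t. (g t - g t0) * ?f t \<partial>unit_lebesgue)"
      using continuous_times_integrable[OF f g] integrable_mult_right[OF f, of "g t0"]
      by (subst Bochner_Integration.integral_diff[symmetric]) (auto simp: left_diff_distrib)
    also have "norm \<dots> \<le> (\<integral>t. norm ((g t - g t0) * ?f t) \<partial>unit_lebesgue)"
      by (rule integral_norm_bound)
    also have "\<dots> \<le> (\<integral>t. e / 2 * norm (?f t) \<partial>unit_lebesgue)"
    proof (rule integral_mono)
      fix t assume "t \<in> space unit_lebesgue"
      then have t: "t \<in> {0..1}" by simp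
      have "norm (g t - g t0) \<le> e / 2" if "t \<in> ?C"
        using d(2)[OF t] near[OF that] n0[OF n] by (force simp: dist_norm)
      then show "norm ((g t - g t0) * ?f t) \<le> e / 2 * norm (?f t)"
        unfolding norm_mult[of "g t - g t0"]
        by (cases "t \<in> ?C") (simp_all only: mult_right_mono norm_ge_zero, simp)
    qed (use int f in auto)
    also have "\<dots> = e / 2"
      using L1_norm_cell_density[OF i, of n, where 'k = 'k]
      by (simp add: cell_density_abs L1_norm_abs[OF f])
    finally show ?thesis using e by (simp add: dist_norm)
  qed
  then show "\<exists>n0. \<forall>n\<ge>n0. dist (measure_integral (L1_to_M (cell_density (M n) (i n))) g) (g t0) < e"
    by blast
qed

text \<open>
  A continuous bump supported in the cell of index \<open>j\<close> isolates the coordinate \<open>x j\<close>.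
\<close>

lemma continuous_functions_separate_J:
  fixes x :: "nat \<Rightarrow> 'k::scalar_field"
  assumes x: "x \<in> pts (ell1 N)"
    and 0: "\<And>g. continuous_on {0..1} g \<Longrightarrow> measure_integral (L1_to_M (J N x)) g = 0"
  shows "x = 0"
proof
  fix j
  have "x j = 0" if j: "j < N"
  proof -
    have N: "0 < N" using j by simp
    \<comment> \<open>The midpoint of the cell and a tent of half-width \<open>1 / (2 * N)\<close> around it, which is at least
      \<open>1 / (4 * N)\<close> on the middle half of the cell.\<close>
    define c where "c = (2 * real j + 1) / (2 * real N)"
    define b where "b t = max 0 (1 / (2 * real N) - \<bar>t - c\<bar>)" for t :: real
    let ?I = "{c - 1 / (4 * real N)..c + 1 / (4 * real N)}"
    have cont: "continuous_on {0..1} b" unfolding b_def by (intro continuous_intros)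
    then have contk: "continuous_on {0..1} (\<lambda>t. of_real (b t) :: 'k)" by (intro continuous_intros)
    have c_eq: "real j / real N = c - 1 / (2 * real N)" "real (Suc j) / real N = c + 1 / (2 * real N)"
      using N by (auto simp: c_def field_simps)
    have supp: "t \<in> cell N j" if "b t \<noteq> 0" for t
    proof -
      have "\<bar>t - c\<bar> < 1 / (2 * real N)" using that by (auto simp: b_def max_def split: if_splits)
      then have "real j / real N < t" "t < real (Suc j) / real N"
        unfolding c_eq by linarith+
      then show ?thesis by (auto simp: cell_def)
    qed
    have intb: "integrable unit_lebesgue b"
      using continuous_times_integrable[OF integrable_indicator_unit[of "{0..1}"] cont]
      by (subst Bochner_Integration.integrable_cong[OF refl, where g = "\<lambda>t. b t * indicator {0..1} t"])
         (auto simp: sets_restrict_space_iff)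
    have I: "?I \<subseteq> cell N j"
    proof
      fix t assume "t \<in> ?I"
      moreover have "1 / (4 * real N) < 1 / (2 * real N)" using N by (simp add: field_simps)
      ultimately have "b t \<noteq> 0" by (auto simp: b_def max_def)
      then show "t \<in> cell N j" by (rule supp)
    qed
    then have I01: "?I \<subseteq> {0..1}" using cell_subset[OF j] by blast
    then have Is: "?I \<in> sets unit_lebesgue" by (auto simp: sets_restrict_space_iff)
    have "measure unit_lebesgue ?I = 1 / (2 * real N)"
      using I01 N by (simp add: measure_restrict_space)
    then have "0 < 1 / (4 * real N) * measure unit_lebesgue ?I" using N by simp
    also have "\<dots> = (\<integral>t. 1 / (4 * real N) * indicator ?I t \<partial>unit_lebesgue)"
      using Is I01 by (simp add: Int_absorb2)
    also have "\<dots> \<le> (\<integral>t. b t \<partial>unit_lebesgue)"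
    proof (intro integral_mono intb integrable_mult_right integrable_indicator_unit Is)
      fix t
      have "1 / (2 * real N) - 1 / (4 * real N) = 1 / (4 * real N)" using N by (simp add: field_simps)
      then show "1 / (4 * real N) * indicator ?I t \<le> b t"
        by (auto simp: indicator_def b_def max_def)
    qed
    finally have pos: "(\<integral>t. b t \<partial>unit_lebesgue) \<noteq> 0" by simp
    have "0 = measure_integral (L1_to_M (J N x)) (\<lambda>t. of_real (b t))"
      using 0[OF contk] ..
    also have "\<dots> = (\<integral>t. of_real (b t) * (\<Sum>i<N. x i * (of_nat N * indicator (cell N i) t)) \<partial>unit_lebesgue)"
      by (simp only: J_abs measure_integral_L1_to_M[OF integrable_step contk])
    also have "\<dots> = (\<integral>t. (x j * of_nat N) * of_real (b t) \<partial>unit_lebesgue)"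
    proof (intro Bochner_Integration.integral_cong refl)
      fix t
      show "of_real (b t) * (\<Sum>i<N. x i * (of_nat N * indicator (cell N i) t)) = (x j * of_nat N) * of_real (b t)"
        using sum_indicator_cells[OF supp j, of t "\<lambda>i. x i * of_nat N"]
        by (cases "b t = 0") (auto simp: mult_ac)
    qed
    also have "\<dots> = x j * of_nat N * of_real (\<integral>t. b t \<partial>unit_lebesgue)"
      using intb by simp
    finally show "x j = 0" using N pos by simp
  qed
  then show "x j = 0 j" using x by (cases "j < N") (auto simp: ell1_def)
qed

text \<open>
  Convergence in an initial topology is convergence after each of the defining maps.
\<close>

lemma limitin_weak_star:
  fixes \<mu> :: "nat \<Rightarrow> real set \<Rightarrow> 'k::scalar_field"
  shows "limitin weak_star \<mu> \<nu> sequentially \<longleftrightarrow>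
    \<nu> \<in> pts M_space \<and> (\<forall>\<^sub>F n in sequentially. \<mu> n \<in> pts M_space) \<and>
    (\<forall>g. continuous_on {0..1} g \<longrightarrow> (\<lambda>n. measure_integral (\<mu> n) g) \<longlonglongrightarrow> measure_integral \<nu> g)"
  (is "_ \<longleftrightarrow> ?R")
proof -
  let ?G = "{g :: real \<Rightarrow> 'k. continuous_on {0..1} g}"
  let ?\<phi> = "\<lambda>\<mu> :: real set \<Rightarrow> 'k. \<lambda>g\<in>?G. measure_integral \<mu> g"
  let ?T = "product_topology (\<lambda>_. euclidean) ?G :: ((real \<Rightarrow> 'k) \<Rightarrow> 'k) topology"
  have \<phi>: "?\<phi> \<mu> \<in> topspace ?T" for \<mu> by (simp add: PiE_def)
  have T: "openin weak_star U \<longleftrightarrow> (\<exists>W. openin ?T W \<and> U = ?\<phi> -` W \<inter> pts M_space)"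
    for U :: "(real set \<Rightarrow> 'k) set"
    by (simp add: weak_star_def openin_pullback_topology)
  have top: "topspace weak_star = (pts M_space :: (real set \<Rightarrow> 'k) set)"
  proof -
    have "?\<phi> -` topspace ?T = UNIV" using \<phi> by (intro equalityI subset_UNIV subsetI vimageI2)
    then show ?thesis unfolding weak_star_def topspace_pullback_topology by simp
  qed
  have "limitin weak_star \<mu> \<nu> sequentially \<longleftrightarrow> \<nu> \<in> pts M_space \<and>
    (\<forall>\<^sub>F n in sequentially. \<mu> n \<in> pts M_space) \<and> limitin ?T (\<lambda>n. ?\<phi> (\<mu> n)) (?\<phi> \<nu>) sequentially"
  proof (intro iffI conjI; (elim conjE)?)
    assume L: "limitin weak_star \<mu> \<nu> sequentially"
    show \<nu>: "\<nu> \<in> pts M_space" using limitin_topspace[OF L] by (simp only: top)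
    show "\<forall>\<^sub>F n in sequentially. \<mu> n \<in> pts M_space"
      using limitinD[OF L openin_topspace] \<nu> by (simp only: top)
    show "limitin ?T (\<lambda>n. ?\<phi> (\<mu> n)) (?\<phi> \<nu>) sequentially"
      unfolding limitin_def
    proof (intro conjI \<phi> allI impI, elim conjE)
      fix W assume W: "openin ?T W" "?\<phi> \<nu> \<in> W"
      then have "openin weak_star (?\<phi> -` W \<inter> pts M_space)" unfolding T by blast
      from limitinD[OF L this] W(2) \<nu>
      have "\<forall>\<^sub>F n in sequentially. \<mu> n \<in> ?\<phi> -` W \<inter> pts M_space" by blast
      then show "\<forall>\<^sub>F n in sequentially. ?\<phi> (\<mu> n) \<in> W" by (rule eventually_mono) blast
    qed
  next
    assume \<nu>: "\<nu> \<in> pts M_space" and ev: "\<forall>\<^sub>F n in sequentially. \<mu> n \<in> pts M_space"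
      and L: "limitin ?T (\<lambda>n. ?\<phi> (\<mu> n)) (?\<phi> \<nu>) sequentially"
    show "limitin weak_star \<mu> \<nu> sequentially"
      unfolding limitin_def
    proof (intro conjI allI impI, unfold top, rule \<nu>, elim conjE)
      fix U assume "openin weak_star U" and \<nu>U: "\<nu> \<in> U"
      then obtain W where W: "openin ?T W" "U = ?\<phi> -` W \<inter> pts M_space" unfolding T by blast
      have "\<forall>\<^sub>F n in sequentially. ?\<phi> (\<mu> n) \<in> W"
        using limitinD[OF L W(1)] \<nu>U W(2) by blast
      with ev show "\<forall>\<^sub>F n in sequentially. \<mu> n \<in> U"
        unfolding W(2) by eventually_elim blast
    qed
  qed
  moreover have "limitin ?T (\<lambda>n. ?\<phi> (\<mu> n)) (?\<phi> \<nu>) sequentially \<longleftrightarrow>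
      (\<forall>g. continuous_on {0..1} g \<longrightarrow> (\<lambda>n. measure_integral (\<mu> n) g) \<longlonglongrightarrow> measure_integral \<nu> g)"
    unfolding limitin_componentwise using \<phi> by simp
  ultimately show ?thesis by simp
qed

section \<open>Duplication-stable subspaces\<close>

locale duplication_stable_subspace =
  fixes V :: "(nat \<Rightarrow> 'k::scalar_field) set" and N :: nat
  assumes stable: "duplication_stable N V" and N: "0 < N"
begin

lemma V_subset: "V \<subseteq> pts (ell1 N)"
  using stable by (simp add: duplication_stable_def)

lemma duplicate_V: "1 \<le> m \<Longrightarrow> duplicate m ` V \<subseteq> pts (ell1 (N * m))"
  using V_subset duplicate_pts by blast

lemma J_duplicate_V: "1 \<le> m \<Longrightarrow> J (N * m) ` duplicate m ` V = J N ` V"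
  using N by (simp add: image_image J_duplicate)

lemma unique_duplicate:
  "1 \<le> m \<Longrightarrow> \<exists>!P. minimal_projection (ell1 (N * m)) (duplicate m ` V) P"
  using stable by (simp add: duplication_stable_def)

lemma unique: "\<exists>!P. minimal_projection (ell1 N) V P"
proof -
  have "duplicate 1 ` V = V" by (simp add: duplicate_def)
  then show ?thesis using unique_duplicate[of 1] by simp
qed

sublocale L1: contractive_retract "ell1 N" L1_space "J N" "cell_mass N \<circ> L1_to_M"
  using N by (rule contractive_retract_L1)

sublocale M: contractive_retract "ell1 N" M_space "L1_to_M \<circ> J N" "cell_mass N"
  using N by (rule contractive_retract_M)

text \<open>
  For each \<open>m\<close> the copy of \<open>V\<close> is also the copy of its \<open>m\<close>-fold duplication, whose minimal projection
  is unique. So minimal projections agree on the step functions over the finer partition, and not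
  only on those over the original one.
\<close>

lemma minimal_L1_agree:
  assumes "1 \<le> m" "minimal_projection L1_space (J N ` V) Q" "minimal_projection L1_space (J N ` V) Q'"
    and "x \<in> pts (ell1 (N * m))"
  shows "Q (J (N * m) x) = Q' (J (N * m) x)"
proof -
  interpret R: contractive_retract "ell1 (N * m)" L1_space "J (N * m)" "cell_mass (N * m) \<circ> L1_to_M"
    using N assms(1) by (intro contractive_retract_L1) simp
  show ?thesis
    using assms
    by (intro R.minimal_projections_agree[OF duplicate_V unique_duplicate]) (simp_all only: J_duplicate_V)
qed

lemma minimal_M_agree:
  assumes "1 \<le> m" "minimal_projection M_space (L1_to_M ` J N ` V) Q"
    "minimal_projection M_space (L1_to_M ` J N ` V) Q'"
    and "x \<in> pts (ell1 (N * m))"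
  shows "Q (L1_to_M (J (N * m) x)) = Q' (L1_to_M (J (N * m) x))"
proof -
  interpret R: contractive_retract "ell1 (N * m)" M_space "L1_to_M \<circ> J (N * m)" "cell_mass (N * m)"
    using N assms(1) by (intro contractive_retract_M) simp
  have "(L1_to_M \<circ> J (N * m)) ` duplicate m ` V = L1_to_M ` J N ` V"
    using assms(1) by (simp only: image_comp[symmetric] J_duplicate_V)
  then show ?thesis
    using R.minimal_projections_agree[OF duplicate_V unique_duplicate, of Q Q' x] assms by simp
qed

text \<open>
  The set on which two minimal projections agree is a closed subspace, and it contains the densities
  of all cells of all refinements.
\<close>

lemma unique_L1: "\<exists>!Q. minimal_projection L1_space (J N ` V) Q"
proof (rule ex_ex1I)
  show "\<exists>Q. minimal_projection L1_space (J N ` V) Q"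
    using unique L1.inflate_minimal[OF V_subset] by blast
next
  fix Q Q' :: "'k L1 \<Rightarrow> 'k L1"
  assume Q: "minimal_projection L1_space (J N ` V) Q" and Q': "minimal_projection L1_space (J N ` V) Q'"
  have add: "P (u + v) = P u + P v" and scale: "P (L1_scale c u) = L1_scale c (P u)"
    if "minimal_projection L1_space (J N ` V) P" for P u v c
    using that by (auto simp: minimal_projection_def bounded_projection_def linear_on_space_def L1_space_def)
  have diff: "P (u - v) = P u - P v" if "minimal_projection L1_space (J N ` V) P" for P u v
    using add[OF that, of "u - v" v] by simp
  have bounded: "\<exists>C. \<forall>u. L1_norm (P u) \<le> C * L1_norm u" if "minimal_projection L1_space (J N ` V) P" for P
    using that by (auto simp: minimal_projection_def bounded_projection_def bounded_on_space_def L1_space_def)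
  obtain C where C: "\<And>u. L1_norm (Q u) \<le> C * L1_norm u" using bounded[OF Q] by blast
  obtain C' where C': "\<And>u. L1_norm (Q' u) \<le> C' * L1_norm u" using bounded[OF Q'] by blast
  interpret closed_subspace_with_cells "{u. Q u = Q' u}" N
  proof
    fix u :: "'k L1" and s :: "nat \<Rightarrow> 'k L1"
    assume s: "\<And>i. s i \<in> {u. Q u = Q' u}" and lim: "(\<lambda>i. L1_norm (u - s i)) \<longlonglongrightarrow> 0"
    have le: "L1_norm (Q u - Q' u) \<le> (C + C') * L1_norm (u - s i)" for i
    proof -
      have "Q u - Q' u = Q (u - s i) + - Q' (u - s i)"
        using s[of i] by (simp add: diff[OF Q] diff[OF Q'])
      then have "L1_norm (Q u - Q' u) \<le> L1_norm (Q (u - s i)) + L1_norm (Q' (u - s i))"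
        using L1_norm_add[of "Q (u - s i)" "- Q' (u - s i)"] by (simp only: L1_norm_minus)
      then show ?thesis using C[of "u - s i"] C'[of "u - s i"] by (simp add: distrib_right)
    qed
    have "L1_norm (Q u - Q' u) \<le> 0"
      using tendsto_mult_right_zero[OF lim, of "C + C'"] le by (intro LIMSEQ_le_const) auto
    then have "Q u - Q' u = 0" using L1_norm_nonneg L1_norm_eq_0 order_antisym by metis
    then show "u \<in> {u. Q u = Q' u}" by simp
  next
    fix m i assume m: "1 \<le> m" and i: "i < N * m"
    let ?e = "\<lambda>j. if j = i then 1 else 0 :: 'k"
    have "?e \<in> pts (ell1 (N * m))" using i by (auto simp: ell1_def)
    from minimal_L1_agree[OF m Q Q' this] show "cell_density (N * m) i \<in> {u. Q u = Q' u}"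
      using i by (simp add: J_unit)
  qed (use N in \<open>auto simp: add[OF Q] add[OF Q'] scale[OF Q] scale[OF Q']\<close>)
  show "Q = Q'" using Z_UNIV by (intro ext) simp
qed

text \<open>
  On step functions over any refinement, \<open>Q\<close> is the inflation of the minimal projection \<open>P\<close> of the
  sequence space, so it sends the density of a fine cell to the copy of \<open>P e\<close>, where \<open>e\<close> is the unit
  vector of the coarse cell around it. Fine cells directly to the left and to the right of a common
  endpoint of two coarse cells have densities whose difference tends to 0 in the weak* topology, but
  \<open>Q\<close> sends each of these differences to the same vector. Continuity makes this vector vanish.
  Therefore \<open>P\<close> takes the same value at adjacent unit vectors, so at all of them, and its rank is at
  most one.
\<close>

lemma weak_star_continuous_minimal_dim:
  assumes Q: "minimal_projection M_space (L1_to_M ` J N ` V) Q"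
    and cont: "continuous_map weak_star weak_star Q"
  shows "pw.dim V \<le> 1"
proof -
  obtain P where P: "minimal_projection (ell1 N) V P" using unique by blast
  let ?e = "\<lambda>i j. if j = i then 1 else 0 :: 'k"
  have P_V: "P x \<in> V" and P_add: "P (x + y) = P x + P y" and P_scale: "P (pw_scale c x) = pw_scale c (P x)"
    if "x \<in> pts (ell1 N)" "y \<in> pts (ell1 N)" for x y c
    using P that
    by (auto simp: minimal_projection_def bounded_projection_def linear_on_space_def ell1_def)
  have P_id: "P x = x" if "x \<in> V" for x
    using P that by (auto simp: minimal_projection_def bounded_projection_def)
  have e_pts: "?e i \<in> pts (ell1 N)" if "i < N" for i
    using that by (auto simp: ell1_def)
  have inflate: "minimal_projection M_space (L1_to_M ` J N ` V) (M.inflate P)"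
    using M.inflate_minimal[OF V_subset P] by (simp add: image_comp)
  have adjacent: "P (?e (j - 1)) = P (?e j)" if j: "1 \<le> j" "j < N" for j
  proof -
    \<comment> \<open>In the partition into \<open>?M n\<close> cells, \<open>?a n\<close> and \<open>?b n\<close> are the cells that end and start at \<open>t0\<close>.\<close>
    let ?M = "\<lambda>n. N * Suc n" and ?a = "\<lambda>n. j * Suc n - 1" and ?b = "\<lambda>n. j * Suc n"
    define t0 where "t0 = real j / real N"
    define u where "u n = (cell_density (?M n) (?a n) - cell_density (?M n) (?b n) :: 'k L1)" for n
    define z where "z = P (?e (j - 1) - ?e j)"
    have b: "?b n < ?M n" for n
      using j(2) by (rule mult_less_mono1) simp
    then have a: "?a n < ?M n" for n
      by (rule less_imp_diff_less)
    have a_div: "?a n div Suc n = j - 1" for n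
    proof -
      have "?a n = n + (j - 1) * Suc n" using j(1) by (cases j) simp_all
      then show ?thesis by (simp only: div_mult_self1[OF nat.distinct(2)] div_less lessI add_0_right)
    qed
    have b_div: "?b n div Suc n = j" for n by (rule nonzero_mult_div_cancel_right) simp
    have diff_pts: "?e (j - 1) - ?e j \<in> pts (ell1 N)" using j by (auto simp: ell1_def)
    have z: "z \<in> pts (ell1 N)" using P_V[OF diff_pts diff_pts] V_subset by (auto simp: z_def)
    have Q_u: "Q (L1_to_M (u n)) = L1_to_M (J N z)" for n
    proof -
      have pts: "?e (?a n) - ?e (?b n) \<in> pts (ell1 (?M n))"
        using a[of n] b[of n] by (auto simp: ell1_def)
      have u: "u n = J (?M n) (?e (?a n) - ?e (?b n))"
        using a[of n] b[of n] by (simp only: u_def J_diff J_unit)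
      have "cell_mass N (L1_to_M (u n)) = ?e (j - 1) - ?e j"
      proof
        fix k
        show "cell_mass N (L1_to_M (u n)) k = (?e (j - 1) - ?e j) k"
        proof (cases "k < N")
          case True
          have "cell_mass N (L1_to_M (u n)) k
              = (\<Sum>i | i < ?M n \<and> i div Suc n = k. ?e (?a n) i) - (\<Sum>i | i < ?M n \<and> i div Suc n = k. ?e (?b n) i)"
            unfolding u by (subst cell_mass_J[OF True]) (simp_all add: sum_subtractf)
          also have "\<dots> = (?e (j - 1) - ?e j) k"
            using a[of n] b[of n] a_div[of n] b_div[of n] by (auto simp: sum.delta)
          finally show ?thesis .
        next
          case False
          then show ?thesis using j by (auto simp: cell_mass_def)
        qed
      qed
      moreover have "Q (L1_to_M (u n)) = M.inflate P (L1_to_M (u n))"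
        unfolding u using minimal_M_agree[OF _ Q inflate pts] by simp
      ultimately show ?thesis
        by (simp add: L1_to_M_pts M.inflate_def z_def)
    qed
    have zero: "L1_to_M (0 :: 'k L1) = 0" by (transfer; auto simp: set_lebesgue_integral_def)
    have "limitin weak_star (\<lambda>n. L1_to_M (u n)) 0 sequentially"
      unfolding limitin_weak_star
    proof (intro conjI allI impI)
      fix g :: "real \<Rightarrow> 'k" assume g: "continuous_on {0..1} g"
      have t0: "t0 \<in> {0..1}" using j by (auto simp: t0_def)
      have M_lim: "(\<lambda>n. 1 / real (?M n)) \<longlonglongrightarrow> 0"
        using tendsto_mult_right_zero[OF LIMSEQ_Suc[OF lim_1_over_n], of "1 / real N"] by (simp add: distrib_left)
      have b_eq: "real (?b n) / real (?M n) = t0" for n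
        unfolding t0_def of_nat_mult by (rule nonzero_mult_divide_mult_cancel_right) simp
      have "\<bar>t - t0\<bar> \<le> 1 / real (?M n)" if t: "t \<in> cell (?M n) (?b n)" for n t
        using cell_bounds(1)[OF t] cell_width[OF t] unfolding b_eq by linarith
      then have lim_b: "(\<lambda>n. measure_integral (L1_to_M (cell_density (?M n) (?b n))) g) \<longlonglongrightarrow> g t0"
        by (rule cell_density_tendsto_point_mass[OF g t0 b M_lim])
      have "\<bar>t - t0\<bar> \<le> 1 / real (?M n)" if t: "t \<in> cell (?M n) (?a n)" for n t
      proof -
        have "0 < ?b n" using j(1) by simp
        then have "real (?b n) = real (?a n) + 1" by linarith
        then have "t0 = real (?a n) / real (?M n) + 1 / real (?M n)"
          using b_eq[of n] by (simp only: add_divide_distrib)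
        then show ?thesis using cell_bounds(1)[OF t] cell_width[OF t] by linarith
      qed
      then have lim_a: "(\<lambda>n. measure_integral (L1_to_M (cell_density (?M n) (?a n))) g) \<longlonglongrightarrow> g t0"
        by (rule cell_density_tendsto_point_mass[OF g t0 a M_lim])
      show "(\<lambda>n. measure_integral (L1_to_M (u n)) g) \<longlonglongrightarrow> measure_integral 0 g"
        using tendsto_diff[OF lim_a lim_b] measure_integral_zero[OF g]
        by (simp add: u_def measure_integral_diff[OF g] zero)
    qed (simp_all add: zero_M L1_to_M_pts)
    from continuous_map_limit[OF cont this]
    have lim: "limitin weak_star (\<lambda>n. L1_to_M (J N z)) (Q 0) sequentially"
      by (simp add: comp_def Q_u)
    have "\<forall>\<mu>\<in>pts M_space. \<forall>\<nu>\<in>pts M_space. Q (\<mu> + \<nu>) = Q \<mu> + Q \<nu>"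
      using Q by (simp add: minimal_projection_def bounded_projection_def linear_on_space_def)
    then have "Q (0 + 0) = Q 0 + Q 0"
      by (blast intro: zero_M(1))
    then have "Q 0 = 0" by simp
    then have "measure_integral (L1_to_M (J N z)) g = 0" if "continuous_on {0..1} g" for g
      using lim that measure_integral_zero[OF that] unfolding limitin_weak_star
      by (auto simp: zero LIMSEQ_const_iff)
    then have "z = 0" by (rule continuous_functions_separate_J[OF z])
    moreover have "P (?e (j - 1)) = z + P (?e j)"
      using P_add[OF diff_pts e_pts[OF j(2)]] by (simp add: z_def)
    ultimately show ?thesis by simp
  qed
  have same: "P (?e i) = P (?e 0)" if "i < N" for i
    using that
  proof (induction i)
    case (Suc i)
    then show ?case using adjacent[of "Suc i"] by simp
  qed simp
  have "V \<subseteq> pw.span {P (?e 0)}"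
  proof
    fix x assume x: "x \<in> V"
    \<comment> \<open>The truncations of \<open>x\<close> add one coordinate at a time.\<close>
    define y where "y n = (\<lambda>j. if j < n then x j else 0)" for n
    have "P (y n) \<in> pw.span {P (?e 0)}" if "n \<le> N" for n
      using that
    proof (induction n)
      case 0
      have "P (y 0 + y 0) = P (y 0) + P (y 0)" by (rule P_add) (auto simp: y_def ell1_def)
      moreover have "y 0 + y 0 = y 0" by (auto simp: y_def)
      ultimately have "P (y 0) = 0" by simp
      then show ?case by (simp only: pw.span_zero)
    next
      case (Suc n)
      have y: "y (Suc n) = y n + pw_scale (x n) (?e n)"
        by (auto simp: y_def pw_scale_def less_Suc_eq)
      have "y n \<in> pts (ell1 N)" "pw_scale (x n) (?e n) \<in> pts (ell1 N)"
        using Suc.prems by (auto simp: y_def ell1_def pw_scale_def)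
      then have "P (y (Suc n)) = P (y n) + pw_scale (x n) (P (?e 0))"
        using P_add P_scale[OF e_pts e_pts, of n n] same[of n] Suc.prems by (simp add: y)
      moreover have "P (y n) \<in> pw.span {P (?e 0)}"
        using Suc by simp
      ultimately show ?case
        by (simp only: pw.span_add pw.span_scale pw.span_base singletonI)
    qed
    moreover have "y N = x"
    proof -
      have "x j = 0" if "N \<le> j" for j using x V_subset that by (auto simp: ell1_def)
      then show ?thesis by (auto simp: y_def)
    qed
    ultimately show "x \<in> pw.span {P (?e 0)}" using P_id[OF x] by force
  qed
  then have "pw.dim V \<le> card {P (?e 0)}" by (rule pw.dim_le_card) simp
  then show ?thesis by simp
qed

end

theorem theorem4p4:
  fixes V :: "(nat \<Rightarrow> 'k::scalar_field) set" and N n :: nat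
  assumes "duplication_stable N V"
    and "pw.dim V = n"
    and "n \<ge> 2"
  shows "(proj_const L1_space (J N ` V) = proj_const (ell1 N) V \<and>
          proj_const M_space (L1_to_M ` J N ` V) = proj_const (ell1 N) V) \<and>
         (\<exists>!P. minimal_projection L1_space (J N ` V) P) \<and>
         \<not> (\<exists>Q. minimal_projection M_space (L1_to_M ` J N ` V) Q \<and>
                continuous_map weak_star weak_star Q)"
proof -
  have "0 < N"
  proof (rule ccontr)
    assume "\<not> 0 < N"
    then have "V \<subseteq> {0}"
      using assms(1) by (force simp: duplication_stable_def ell1_def fun_eq_iff)
    then have "V \<subseteq> pw.span {}" by (simp add: pw.span_empty)
    then have "pw.dim V \<le> card ({} :: (nat \<Rightarrow> 'k) set)" by (rule pw.dim_le_card) simp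
    then show False using assms(2,3) by simp
  qed
  with assms(1) interpret duplication_stable_subspace V N by unfold_locales
  show ?thesis
    using L1.proj_const_eq[OF V_subset] M.proj_const_eq[OF V_subset] unique_L1
      weak_star_continuous_minimal_dim assms(2,3)
    by (auto simp: image_comp)
qed

end
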